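(* Let $g,h\in S=\mathbb{C}[x,y,z,t]$ be homogeneous polynomials with $\deg g=\deg h=k\ge 2$, and assume that the base locus $$B=\{g=h=0\}\subset\mathbb{P}^3$$ of the pencil $\mathcal P:\alpha g+\beta h=0$ is a reduced curve. Let $\omega(\mathcal P)=\mathrm{d}g\wedge \mathrm{d}h$ and $$\omega^x=\mathrm{d}x\wedge\omega(\mathcal P),\quad \omega^y=\mathrm{d}y\wedge\omega(\mathcal P),\quad \omega^z=\mathrm{d}z\wedge\omega(\mathcal P),\quad \omega^t=\mathrm{d}t\wedge\omega(\mathcal P).$$ If a linear dependence relation $$c^x\omega^x+c^y\omega^y+c^z\omega^z+c^t\omega^t=0$$ holds with $c^x,c^y,c^z,c^t\in\mathbb{C}$ not all zero, then the curve $B$ is contained in the plane $$H:\ \ell=c^xx+c^yy+c^zz+c^tt=0.$$ In particular, the differential forms $\omega^x,\omega^y,\omega^z,\omega^t$ span a $\mathbb{C}$-vector space of dimension $3$ or $4$.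
   Context: The pencil $\mathcal P$ consists of the surfaces $\alpha g+\beta h=0$ in $\mathbb{P}^3$ with $\alpha,\beta\in\mathbb{C}$. The differential forms are polynomial differential forms on $\mathbb{C}^4$ (with coefficients in $S$), and $\mathrm{d}$ is the exterior derivative. The base locus $B$ is regarded as the subscheme of $\mathbb{P}^3$ defined by the ideal $(g,h)$; the assumption is that it is a curve (dimension $1$) and is reduced. *)

theory Defs
  imports "HOL-Analysis.Analysis" "HOL-Library.Poly_Mapping"
begin

section \<open>The polynomial ring \<open>S = \<complex>[x,y,z,t]\<close>\<close>

datatype coord = Cx | Cy | Cz | Ct

lemma UNIV_coord: "(UNIV :: coord set) = {Cx, Cy, Cz, Ct}"
  using coord.exhaust by auto

instance coord :: finite
  by standard (simp add: UNIV_coord)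

text \<open>The order \<open>x < y < z < t\<close> fixes the signs in the standard basis of the exterior algebra.\<close>

primrec coord_index :: "coord \<Rightarrow> nat" where
  "coord_index Cx = 0"
| "coord_index Cy = 1"
| "coord_index Cz = 2"
| "coord_index Ct = 3"

lemma inj_coord_index: "coord_index i = coord_index j \<Longrightarrow> i = j"
  by (cases i; cases j) simp_all

instantiation coord :: linorder
begin

definition less_eq_coord :: "coord \<Rightarrow> coord \<Rightarrow> bool" where
  "i \<le> j \<longleftrightarrow> coord_index i \<le> coord_index j"

definition less_coord :: "coord \<Rightarrow> coord \<Rightarrow> bool" where
  "i < j \<longleftrightarrow> coord_index i < coord_index j"

instance
  by standard (auto simp: less_eq_coord_def less_coord_def intro: inj_coord_index)

end

type_synonym poly4 = "(coord \<Rightarrow>\<^sub>0 nat) \<Rightarrow>\<^sub>0 complex"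

definition Const :: "complex \<Rightarrow> poly4" where
  "Const c = Poly_Mapping.single 0 c"

definition Var :: "coord \<Rightarrow> poly4" where
  "Var i = Poly_Mapping.single (Poly_Mapping.single i 1) 1"

definition mon_degree :: "(coord \<Rightarrow>\<^sub>0 nat) \<Rightarrow> nat" where
  "mon_degree m = (\<Sum>i\<in>UNIV. Poly_Mapping.lookup m i)"

text \<open>The zero polynomial is homogeneous of every degree.\<close>

definition homogeneous :: "nat \<Rightarrow> poly4 \<Rightarrow> bool" where
  "homogeneous k f \<longleftrightarrow> (\<forall>m\<in>Poly_Mapping.keys f. mon_degree m = k)"

definition mon_eval :: "(coord \<Rightarrow>\<^sub>0 nat) \<Rightarrow> complex ^ coord \<Rightarrow> complex" where
  "mon_eval m v = (\<Prod>i\<in>UNIV. (v $ i) ^ Poly_Mapping.lookup m i)"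

definition poly_eval :: "poly4 \<Rightarrow> complex ^ coord \<Rightarrow> complex" where
  "poly_eval f v = (\<Sum>m\<in>Poly_Mapping.keys f. Poly_Mapping.lookup f m * mon_eval m v)"

text \<open>Monomials not containing the variable \<open>i\<close> contribute coefficient 0, so the truncated
  subtraction of exponents is harmless.\<close>

definition partial_deriv :: "coord \<Rightarrow> poly4 \<Rightarrow> poly4" where
  "partial_deriv i f = (\<Sum>m\<in>Poly_Mapping.keys f.
     Poly_Mapping.single (m - Poly_Mapping.single i 1)
       (of_nat (Poly_Mapping.lookup m i) * Poly_Mapping.lookup f m))"

global_interpretation ideal: module "(*) :: poly4 \<Rightarrow> poly4 \<Rightarrow> poly4"
  by standard (simp_all add: algebra_simps)

section \<open>Polynomial differential forms on \<open>\<complex>\<^sup>4\<close>\<close>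

text \<open>The component of a form at \<open>K = {i\<^sub>1 < \<dots> < i\<^sub>p}\<close> is the coefficient of
  \<open>dx\<^bsub>i\<^sub>1\<^esub> \<and> \<dots> \<and> dx\<^bsub>i\<^sub>p\<^esub>\<close>; forms of all degrees live in one free \<open>S\<close>-module of rank 16.\<close>

type_synonym form = "poly4 ^ (coord set)"

definition form0 :: "poly4 \<Rightarrow> form" where
  "form0 f = (\<chi> K. if K = {} then f else 0)"

text \<open>The sign of the permutation sorting the elements of \<open>I\<close> followed by those of \<open>J\<close>.\<close>

definition shuffle_sign :: "coord set \<Rightarrow> coord set \<Rightarrow> poly4" where
  "shuffle_sign I J = (- 1) ^ card {(i, j). i \<in> I \<and> j \<in> J \<and> j < i}"

definition wedge :: "form \<Rightarrow> form \<Rightarrow> form"  (infixr "\<and>\<^sub>d" 70) where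
  "\<alpha> \<and>\<^sub>d \<beta> = (\<chi> K. \<Sum>I\<in>Pow K. shuffle_sign I (K - I) * (\<alpha> $ I) * (\<beta> $ (K - I)))"

text \<open>\<open>d(f dx\<^sub>J) = \<Sum>\<^sub>i \<partial>\<^sub>if dx\<^sub>i \<and> dx\<^sub>J\<close>.\<close>

definition ext_deriv :: "form \<Rightarrow> form" where
  "ext_deriv \<alpha> = (\<chi> K. \<Sum>i\<in>K. shuffle_sign {i} (K - {i}) * partial_deriv i (\<alpha> $ (K - {i})))"

abbreviation dfun :: "poly4 \<Rightarrow> form" where
  "dfun f \<equiv> ext_deriv (form0 f)"

definition form_scale :: "complex \<Rightarrow> form \<Rightarrow> form" where
  "form_scale c \<alpha> = Const c *s \<alpha>"

lemma Const_add: "Const (a + b) = Const a + Const b"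
  by (simp add: Const_def single_add)

lemma Const_mult: "Const (a * b) = Const a * Const b"
  by (simp add: Const_def mult_single)

lemma Const_1: "Const 1 = 1"
  by (simp add: Const_def)

global_interpretation forms: vector_space form_scale
  by standard
    (simp_all add: form_scale_def Const_add Const_mult Const_1 vector_add_ldistrib
      vector_sadd_rdistrib vector_smult_assoc)

definition pencil_form :: "poly4 \<Rightarrow> poly4 \<Rightarrow> form" where
  "pencil_form g h = dfun g \<and>\<^sub>d dfun h"

definition pencil_form_at :: "coord \<Rightarrow> poly4 \<Rightarrow> poly4 \<Rightarrow> form" where
  "pencil_form_at i g h = dfun (Var i) \<and>\<^sub>d pencil_form g h"

section \<open>Projective space and its Zariski topology\<close>

typedef proj3 = "{L :: (complex ^ coord) set. \<exists>v. v \<noteq> 0 \<and> L = range (\<lambda>c. c *s v)}"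
  by (rule exI[of _ "range (\<lambda>c. c *s (1 :: complex ^ coord))"]) (auto intro!: exI[of _ 1])

text \<open>Points are lines through the origin, and a polynomial vanishes at a point if it vanishes on
  the whole line. For homogeneous polynomials a single nonzero representative suffices
  (\<open>vanishes_iff\<close> below).\<close>

definition vanishes_at :: "poly4 \<Rightarrow> proj3 \<Rightarrow> bool" where
  "vanishes_at f p \<longleftrightarrow> (\<forall>v\<in>Rep_proj3 p. poly_eval f v = 0)"

definition zero_locus :: "poly4 set \<Rightarrow> proj3 set" where
  "zero_locus F = {p. \<forall>f\<in>F. vanishes_at f p}"

definition zariski_closed :: "proj3 set \<Rightarrow> bool" where
  "zariski_closed Z \<longleftrightarrow> (\<exists>F. (\<forall>f\<in>F. \<exists>k. homogeneous k f) \<and> Z = zero_locus F)"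

definition irreducible_closed :: "proj3 set \<Rightarrow> bool" where
  "irreducible_closed Z \<longleftrightarrow> zariski_closed Z \<and> Z \<noteq> {} \<and>
     (\<forall>A B. zariski_closed A \<and> zariski_closed B \<and> Z = A \<union> B \<longrightarrow> Z = A \<or> Z = B)"

text \<open>Krull dimension; the supremum in the extended reals gives the empty set dimension
  \<open>- \<infinity>\<close>.\<close>

definition zariski_dim :: "proj3 set \<Rightarrow> ereal" where
  "zariski_dim Z = Sup {ereal (real n) | n. \<exists>C :: nat \<Rightarrow> proj3 set.
     (\<forall>i\<le>n. irreducible_closed (C i) \<and> C i \<subseteq> Z) \<and> (\<forall>i<n. C i \<subset> C (Suc i))}"

section \<open>Closed subschemes of projective space\<close>

text \<open>A closed subscheme is given by a homogeneous ideal \<open>I\<close>. On the standard chart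
  \<open>x\<^sub>i \<noteq> 0\<close>, which is affine 3-space with coordinate ring the polynomials not involving \<open>x\<^sub>i\<close>, it
  is the spectrum of the quotient of that ring by the image of \<open>I\<close> under \<open>x\<^sub>i \<mapsto> 1\<close>.\<close>

definition dehomogenize :: "coord \<Rightarrow> poly4 \<Rightarrow> poly4" where
  "dehomogenize i f = (\<Sum>m\<in>Poly_Mapping.keys f.
     Poly_Mapping.single (Poly_Mapping.update i 0 m) (Poly_Mapping.lookup f m))"

definition chart_ring :: "coord \<Rightarrow> poly4 set" where
  "chart_ring i = {f. \<forall>m\<in>Poly_Mapping.keys f. Poly_Mapping.lookup m i = 0}"

definition chart_ideal :: "coord \<Rightarrow> poly4 set \<Rightarrow> poly4 set" where
  "chart_ideal i I = dehomogenize i ` I"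

text \<open>Reducedness is local: the scheme is reduced iff the coordinate rings
  \<open>chart_ring i / chart_ideal i I\<close> of the four charts have no nonzero nilpotents.\<close>

definition reduced_scheme :: "poly4 set \<Rightarrow> bool" where
  "reduced_scheme I \<longleftrightarrow>
     (\<forall>i. \<forall>f\<in>chart_ring i. (\<exists>n. f ^ n \<in> chart_ideal i I) \<longrightarrow> f \<in> chart_ideal i I)"

definition curve_scheme :: "poly4 set \<Rightarrow> bool" where
  "curve_scheme I \<longleftrightarrow> zariski_dim (zero_locus I) = 1"

text \<open>\<open>subscheme_of I J\<close>: the closed subscheme given by \<open>I\<close> is contained in the one given
  by \<open>J\<close>, i.e. the ideal sheaves satisfy the reverse inclusion.\<close>

definition subscheme_of :: "poly4 set \<Rightarrow> poly4 set \<Rightarrow> bool" where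
  "subscheme_of I J \<longleftrightarrow> (\<forall>i. chart_ideal i J \<subseteq> chart_ideal i I)"

definition base_locus :: "poly4 \<Rightarrow> poly4 \<Rightarrow> poly4 set" where
  "base_locus g h = ideal.span {g, h}"

definition surface :: "poly4 \<Rightarrow> poly4 set" where
  "surface f = ideal.span {f}"

definition linear_poly :: "complex ^ coord \<Rightarrow> poly4" where
  "linear_poly c = (\<Sum>i\<in>UNIV. Const (c $ i) * Var i)"

section \<open>Consistency of the conventions\<close>

lemma poly_eval_superset:
  assumes "finite A" "Poly_Mapping.keys f \<subseteq> A"
  shows "poly_eval f v = (\<Sum>m\<in>A. Poly_Mapping.lookup f m * mon_eval m v)"
  unfolding poly_eval_def
  by (rule sum.mono_neutral_left) (use assms in \<open>auto simp: in_keys_iff\<close>)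

lemma poly_eval_add: "poly_eval (f + g) v = poly_eval f v + poly_eval g v"
proof -
  let ?A = "Poly_Mapping.keys f \<union> Poly_Mapping.keys g"
  have "Poly_Mapping.keys (f + g) \<subseteq> ?A"
    by (rule keys_add)
  then show ?thesis
    by (simp add: poly_eval_superset[of ?A] lookup_add distrib_right sum.distrib)
qed

lemma poly_eval_0: "poly_eval 0 v = 0"
  by (simp add: poly_eval_def)

lemma poly_eval_sum: "poly_eval (sum F A) v = (\<Sum>a\<in>A. poly_eval (F a) v)"
  by (induction A rule: infinite_finite_induct) (simp_all add: poly_eval_add poly_eval_0)

lemma poly_eval_single: "poly_eval (Poly_Mapping.single m c) v = c * mon_eval m v"
  by (cases "c = 0") (simp_all add: poly_eval_def)

lemma poly_eval_dehomogenize: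
  assumes "v $ i = 1"
  shows "poly_eval (dehomogenize i f) v = poly_eval f v"
proof -
  have "mon_eval (Poly_Mapping.update i 0 m) v = mon_eval m v" for m
    unfolding mon_eval_def by (rule prod.cong) (auto simp: lookup_update assms)
  then show ?thesis
    by (simp add: dehomogenize_def poly_eval_sum poly_eval_single) (simp add: poly_eval_def)
qed

lemma poly_eval_scale:
  assumes "homogeneous k f"
  shows "poly_eval f (c *s v) = c ^ k * poly_eval f v"
proof -
  have "mon_eval m (c *s v) = c ^ mon_degree m * mon_eval m v" for m
    by (simp add: mon_eval_def mon_degree_def power_mult_distrib prod.distrib power_sum)
  then show ?thesis
    using assms unfolding poly_eval_def homogeneous_def sum_distrib_left
    by (intro sum.cong) simp_all
qed

lemma Rep_proj3_eq:
  assumes "v \<in> Rep_proj3 p" "v \<noteq> 0"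
  shows "Rep_proj3 p = range (\<lambda>c. c *s v)"
proof -
  obtain w where w: "Rep_proj3 p = range (\<lambda>c. c *s w)"
    using Rep_proj3[of p] by auto
  then obtain a where a: "v = a *s w"
    using assms(1) by auto
  then have "a \<noteq> 0"
    using assms(2) by auto
  then have "c *s w = (c / a) *s v" for c
    using a by (simp add: vector_smult_assoc)
  then have "c *s w \<in> range (\<lambda>c. c *s v)" for c
    by (metis rangeI)
  moreover have "c *s v \<in> range (\<lambda>c. c *s w)" for c
    unfolding a vector_smult_assoc by (rule rangeI)
  ultimately show ?thesis
    unfolding w by blast
qed

lemma vanishes_iff:
  assumes "homogeneous k f" "v \<in> Rep_proj3 p" "v \<noteq> 0"
  shows "vanishes_at f p \<longleftrightarrow> poly_eval f v = 0"
  using assms by (auto simp: vanishes_at_def Rep_proj3_eq poly_eval_scale)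

lemma subscheme_of_imp_points:
  assumes "subscheme_of I J" "f \<in> J" "homogeneous k f"
  shows "zero_locus I \<subseteq> zero_locus {f}"
proof
  fix p assume p: "p \<in> zero_locus I"
  obtain w where w: "w \<noteq> 0" "Rep_proj3 p = range (\<lambda>c. c *s w)"
    using Rep_proj3[of p] by auto
  then obtain i where i: "w $ i \<noteq> 0"
    by (auto simp: vec_eq_iff)
  define v where "v = (1 / (w $ i)) *s w"
  have v: "v \<in> Rep_proj3 p" "v $ i = 1" "v \<noteq> 0"
    using w i by (auto simp: v_def vec_eq_iff)
  obtain q where q: "q \<in> I" "dehomogenize i f = dehomogenize i q"
    using assms(1,2) unfolding subscheme_of_def chart_ideal_def by blast
  then have "poly_eval f v = poly_eval q v"
    using poly_eval_dehomogenize[OF v(2)] by metis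
  also have "\<dots> = 0"
    using p q(1) v(1) by (auto simp: zero_locus_def vanishes_at_def)
  finally show "p \<in> zero_locus {f}"
    using vanishes_iff[OF assms(3) v(1,3)] by (simp add: zero_locus_def)
qed

lemma dfun_component: "dfun f $ K = (if \<exists>i. K = {i} then partial_deriv (THE i. K = {i}) f else 0)"
proof (cases "\<exists>i. K = {i}")
  case True
  then obtain i where i: "K = {i}"
    by blast
  have "shuffle_sign {i} {} = 1"
    by (simp add: shuffle_sign_def)
  then show ?thesis
    by (simp add: i ext_deriv_def form0_def)
next
  case False
  then have "K - {i} \<noteq> {}" if "i \<in> K" for i
    using that by auto
  then show ?thesis
    using False by (simp add: ext_deriv_def form0_def partial_deriv_def)
qed

lemma dfun_Var: "dfun (Var i) = (\<chi> K. if K = {i} then 1 else 0)"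
proof -
  have "partial_deriv j (Var i) = (if j = i then 1 else 0)" for j
    by (simp add: partial_deriv_def Var_def lookup_single when_def)
  then show ?thesis
    by (auto simp: vec_eq_iff dfun_component)
qed

end

theory Submission
  imports Defs "HOL-Computational_Algebra.Polynomial"
    "HOL-Computational_Algebra.Fundamental_Theorem_Algebra"
begin

text \<open>If \<open>d\<ell> \<and> dg \<and> dh = 0\<close>, then \<open>g\<close>, \<open>h\<close> and \<open>\<ell>\<close> are algebraically dependent. As \<open>B\<close> is a curve, \<open>h\<close>
  is a nonzerodivisor modulo \<open>g\<close>, so powers of \<open>g\<close> and \<open>h\<close> can be cancelled from a homogeneous
  relation \<open>\<Sum> \<gamma>\<^sub>a\<^sub>b g\<^sup>a h\<^sup>b \<ell>\<^bsup>N - k(a+b)\<^esup> = 0\<close> until it shows that a power of \<open>\<ell>\<close> lies in \<open>(g,h)\<close>. Reducedness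
  then gives \<open>B \<subseteq> {\<ell> = 0}\<close>.

  If two independent forms \<open>\<ell>\<close>, \<open>\<ell>'\<close> satisfy the relation, take \<open>v \<noteq> 0\<close> with \<open>\<ell>(v) = \<ell>'(v) = 0\<close>. All the
  minors \<open>D\<^sub>v g D\<^sub>u h - D\<^sub>u g D\<^sub>v h\<close> vanish, and Euler's formula yields \<open>D\<^sub>v g = D\<^sub>v h = 0\<close>. So \<open>g\<close> and \<open>h\<close> are
  singular at the point \<open>v\<close>, which contradicts \<open>\<ell> \<in> (g,h)\<close> near \<open>v\<close>.\<close>

text \<open>The algebraic dependence comes from counting: there are more monomials in g, h, \<ell>
  than the space containing them has dimensions. The count needs a direction \<open>w\<close> in ker
  \<ell> with D_w g nonzero; if there is none, g is itself a multiple of a power of \<ell>.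

  The curve hypothesis bounds chains of irreducible closed sets and says nothing directly about
  divisibility. The bridge is a contrapositive: if h is a zero divisor modulo g, a chain point < E <
  C is built inside B. This takes irreducible components, hence the descending chain condition for
  closed sets, hence finite generation of ideals.

  Reducedness speaks of the four charts, so the exponent of \<ell> is removed chart by chart.

  For the dimension claim, fix a relation with nonzero i-th coefficient: every relation with
  vanishing i-th coefficient is then zero, so three of the forms are independent.\<close>

lemma sum_coord: "(\<Sum>i\<in>UNIV. F i) = F Cx + F Cy + F Cz + F Ct"
  by (simp add: UNIV_coord ac_simps)

lemma prod_coord: "(\<Prod>i\<in>UNIV. F i) = F Cx * F Cy * F Cz * F Ct"
  by (simp add: UNIV_coord ac_simps)

section \<open>Substitution homomorphisms\<close>

lemma sum_singles: "(\<Sum>m\<in>Poly_Mapping.keys f. Poly_Mapping.single m (Poly_Mapping.lookup f m)) = f"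
  by (rule poly_mapping_eqI)
    (auto simp: lookup_sum lookup_single when_def in_keys_iff if_distrib sum.delta cong: if_cong)

lemma single_conv_prod_Var:
  "Poly_Mapping.single m c = Const c * (\<Prod>i\<in>UNIV. Var i ^ Poly_Mapping.lookup m i)"
proof -
  have pow: "Var i ^ n = Poly_Mapping.single (Poly_Mapping.single i n) 1" for i n
    by (induction n) (simp_all add: Var_def mult_single flip: single_add)
  have "m = (\<Sum>i\<in>UNIV. Poly_Mapping.single i (Poly_Mapping.lookup m i))"
    by (rule poly_mapping_eqI) (simp add: lookup_sum lookup_single when_def)
  then have "m = Poly_Mapping.single Cx (Poly_Mapping.lookup m Cx) + Poly_Mapping.single Cy (Poly_Mapping.lookup m Cy)
      + Poly_Mapping.single Cz (Poly_Mapping.lookup m Cz) + Poly_Mapping.single Ct (Poly_Mapping.lookup m Ct)"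
    by (simp only: sum_coord)
  then show ?thesis
    by (simp add: prod_coord pow Const_def mult_single flip: single_add)
qed

lemma poly4_induct [case_names Const Var add mult]:
  assumes "\<And>c. P (Const c)" "\<And>i. P (Var i)"
    and "\<And>f g. P f \<Longrightarrow> P g \<Longrightarrow> P (f + g)" "\<And>f g. P f \<Longrightarrow> P g \<Longrightarrow> P (f * g)"
  shows "P f"
proof -
  have 1: "P 1"
    using assms(1)[of 1] by (simp add: Const_1)
  have 0: "P 0"
    using assms(1)[of 0] by (simp add: Const_def)
  have pow: "P (Var i ^ n)" for i n
    by (induction n) (simp_all add: 1 assms)
  have "P (Poly_Mapping.single m c)" for m c
    unfolding single_conv_prod_Var prod_coord by (intro assms pow)
  then have "P (\<Sum>m\<in>A. Poly_Mapping.single m (Poly_Mapping.lookup f m))" for A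
    by (induction A rule: infinite_finite_induct) (auto intro: 0 assms)
  then show ?thesis
    using sum_singles[of f] by metis
qed

text \<open>The scalar embedding \<iota> is a parameter, so that evaluation, restriction to lines
  and planes, the shift along a direction and dehomogenization are instances of one map. It is a
  homomorphism once \<iota> satisfies \<open>scalars\<close>.\<close>

definition subst :: "(complex \<Rightarrow> 'a::comm_ring_1) \<Rightarrow> (coord \<Rightarrow> 'a) \<Rightarrow> poly4 \<Rightarrow> 'a" where
  "subst \<iota> \<theta> f = (\<Sum>m\<in>Poly_Mapping.keys f.
     \<iota> (Poly_Mapping.lookup f m) * (\<Prod>i\<in>UNIV. \<theta> i ^ Poly_Mapping.lookup m i))"

locale scalars =
  fixes \<iota> :: "complex \<Rightarrow> 'a::comm_ring_1"
  assumes \<iota>_add: "\<iota> (a + b) = \<iota> a + \<iota> b"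
    and \<iota>_mult: "\<iota> (a * b) = \<iota> a * \<iota> b"
    and \<iota>_1: "\<iota> 1 = 1"
begin

lemma \<iota>_0: "\<iota> 0 = 0"
  using \<iota>_add[of 0 0] by simp

lemma subst_superset:
  assumes "finite A" "Poly_Mapping.keys f \<subseteq> A"
  shows "subst \<iota> \<theta> f = (\<Sum>m\<in>A. \<iota> (Poly_Mapping.lookup f m) * (\<Prod>i\<in>UNIV. \<theta> i ^ Poly_Mapping.lookup m i))"
  unfolding subst_def
  by (rule sum.mono_neutral_left) (use assms in \<open>auto simp: in_keys_iff \<iota>_0\<close>)

lemma subst_add: "subst \<iota> \<theta> (f + g) = subst \<iota> \<theta> f + subst \<iota> \<theta> g"
proof -
  let ?A = "Poly_Mapping.keys f \<union> Poly_Mapping.keys g"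
  have "Poly_Mapping.keys (f + g) \<subseteq> ?A"
    by (rule keys_add)
  then show ?thesis
    by (simp add: subst_superset[of ?A] lookup_add \<iota>_add distrib_right sum.distrib)
qed

lemma subst_0: "subst \<iota> \<theta> 0 = 0"
  by (simp add: subst_def)

lemma subst_sum: "subst \<iota> \<theta> (sum F A) = (\<Sum>a\<in>A. subst \<iota> \<theta> (F a))"
  by (induction A rule: infinite_finite_induct) (simp_all add: subst_add subst_0)

lemma subst_uminus: "subst \<iota> \<theta> (- f) = - subst \<iota> \<theta> f"
  using subst_add[of \<theta> f "- f"] by (simp add: subst_0 eq_neg_iff_add_eq_0 add.commute)

lemma subst_diff: "subst \<iota> \<theta> (f - g) = subst \<iota> \<theta> f - subst \<iota> \<theta> g"
  using subst_add[of \<theta> f "- g"] by (simp add: subst_uminus)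

lemma subst_single:
  "subst \<iota> \<theta> (Poly_Mapping.single m c) = \<iota> c * (\<Prod>i\<in>UNIV. \<theta> i ^ Poly_Mapping.lookup m i)"
  by (cases "c = 0") (simp_all add: subst_def \<iota>_0)

lemma subst_Const: "subst \<iota> \<theta> (Const c) = \<iota> c"
  by (simp add: Const_def subst_single)

lemma subst_1: "subst \<iota> \<theta> 1 = 1"
  using subst_Const[of \<theta> 1] by (simp add: Const_1 \<iota>_1)

lemma subst_Var: "subst \<iota> \<theta> (Var i) = \<theta> i"
  by (cases i) (simp_all add: Var_def subst_single lookup_single prod_coord \<iota>_1)

lemma subst_mult: "subst \<iota> \<theta> (f * g) = subst \<iota> \<theta> f * subst \<iota> \<theta> g"
proof -
  have single: "subst \<iota> \<theta> (Poly_Mapping.single m a * Poly_Mapping.single n b)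
      = subst \<iota> \<theta> (Poly_Mapping.single m a) * subst \<iota> \<theta> (Poly_Mapping.single n b)" for m n a b
    by (simp add: mult_single subst_single lookup_add power_add prod.distrib \<iota>_mult algebra_simps)
  have "f * g = (\<Sum>m\<in>Poly_Mapping.keys f. \<Sum>n\<in>Poly_Mapping.keys g.
      Poly_Mapping.single m (Poly_Mapping.lookup f m) * Poly_Mapping.single n (Poly_Mapping.lookup g n))"
    by (simp add: sum_singles flip: sum_product)
  then have "subst \<iota> \<theta> (f * g) = (\<Sum>m\<in>Poly_Mapping.keys f. \<Sum>n\<in>Poly_Mapping.keys g.
      subst \<iota> \<theta> (Poly_Mapping.single m (Poly_Mapping.lookup f m))
      * subst \<iota> \<theta> (Poly_Mapping.single n (Poly_Mapping.lookup g n)))"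
    by (simp only: subst_sum single)
  also have "\<dots> = subst \<iota> \<theta> f * subst \<iota> \<theta> g"
    by (simp only: sum_singles flip: sum_product subst_sum)
  finally show ?thesis .
qed

lemma subst_power: "subst \<iota> \<theta> (f ^ n) = subst \<iota> \<theta> f ^ n"
  by (induction n) (simp_all add: subst_mult subst_1)

lemmas subst_simps = subst_add subst_0 subst_sum subst_uminus subst_diff subst_Const subst_1
  subst_Var subst_mult subst_power

lemma subst_unique:
  assumes "\<And>c. \<phi> (Const c) = \<iota> c" "\<And>i. \<phi> (Var i) = \<theta> i"
    and "\<And>f g. \<phi> (f + g) = \<phi> f + \<phi> g" "\<And>f g. \<phi> (f * g) = \<phi> f * \<phi> g"
  shows "\<phi> f = subst \<iota> \<theta> f"
  by (induction f rule: poly4_induct) (simp_all add: assms subst_simps)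

end

interpretation eval: scalars "\<lambda>c. c"
  by standard simp_all

lemma poly_eval_conv_subst: "poly_eval f v = subst (\<lambda>c. c) (\<lambda>i. v $ i) f"
  by (simp add: poly_eval_def subst_def mon_eval_def)

lemmas poly_eval_simps = eval.subst_simps[of "\<lambda>i. v $ i" for v, folded poly_eval_conv_subst]

interpretation Const: scalars Const
  by standard (simp_all add: Const_add Const_mult Const_1)

section \<open>Derivations\<close>

lemma partial_deriv_superset:
  assumes "finite A" "Poly_Mapping.keys f \<subseteq> A"
  shows "partial_deriv i f = (\<Sum>m\<in>A. Poly_Mapping.single (m - Poly_Mapping.single i 1)
       (of_nat (Poly_Mapping.lookup m i) * Poly_Mapping.lookup f m))"
  unfolding partial_deriv_def
  by (rule sum.mono_neutral_left) (use assms in \<open>auto simp: in_keys_iff\<close>)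

lemma partial_deriv_add: "partial_deriv i (f + g) = partial_deriv i f + partial_deriv i g"
proof -
  let ?A = "Poly_Mapping.keys f \<union> Poly_Mapping.keys g"
  have "Poly_Mapping.keys (f + g) \<subseteq> ?A"
    by (rule keys_add)
  then show ?thesis
    by (simp add: partial_deriv_superset[of ?A] lookup_add distrib_left sum.distrib single_add)
qed

lemma partial_deriv_0: "partial_deriv i 0 = 0"
  by (simp add: partial_deriv_def)

lemma partial_deriv_sum: "partial_deriv i (sum F A) = (\<Sum>a\<in>A. partial_deriv i (F a))"
  by (induction A rule: infinite_finite_induct) (simp_all add: partial_deriv_add partial_deriv_0)

lemma partial_deriv_single: "partial_deriv i (Poly_Mapping.single m c) =
    Poly_Mapping.single (m - Poly_Mapping.single i 1) (of_nat (Poly_Mapping.lookup m i) * c)"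
  by (cases "c = 0") (simp_all add: partial_deriv_def)

lemma partial_deriv_Const: "partial_deriv i (Const c) = 0"
  by (simp add: Const_def partial_deriv_single)

lemma partial_deriv_Var: "partial_deriv i (Var j) = (if i = j then 1 else 0)"
  by (simp add: Var_def partial_deriv_single lookup_single when_def)

lemma partial_deriv_mult: "partial_deriv i (f * g) = partial_deriv i f * g + f * partial_deriv i g"
proof -
  let ?s = "Poly_Mapping.single :: (coord \<Rightarrow>\<^sub>0 nat) \<Rightarrow> complex \<Rightarrow> poly4"
  let ?e = "Poly_Mapping.single i (1 :: nat)"
  \<comment> \<open>Exponents are subtracted with truncation, so the exponent of \<open>i\<close>
    must be nonzero. If it is zero, the coefficient factor makes both sides 0.\<close>
  have shift: "m - ?e + n = m + n - ?e" if "Poly_Mapping.lookup m i \<noteq> 0" for m n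
    using that by (intro poly_mapping_eqI) (auto simp: lookup_add lookup_minus lookup_single when_def)
  have shift': "m + (n - ?e) = m + n - ?e" if "Poly_Mapping.lookup n i \<noteq> 0" for m n
    using shift[OF that, of m] by (simp add: add.commute)
  have "partial_deriv i (?s m a) * ?s n b =
      ?s (m + n - ?e) (of_nat (Poly_Mapping.lookup m i) * a * b)" for m n a b
    by (cases "Poly_Mapping.lookup m i = 0") (simp_all add: partial_deriv_single mult_single shift del: One_nat_def)
  moreover have "?s m a * partial_deriv i (?s n b) =
      ?s (m + n - ?e) (a * (of_nat (Poly_Mapping.lookup n i) * b))" for m n a b
    by (cases "Poly_Mapping.lookup n i = 0") (simp_all add: partial_deriv_single mult_single shift' del: One_nat_def)
  ultimately have single: "partial_deriv i (?s m a * ?s n b) = partial_deriv i (?s m a) * ?s n b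
      + ?s m a * partial_deriv i (?s n b)" for m n a b
    by (simp add: mult_single partial_deriv_single lookup_add algebra_simps flip: single_add)
  let ?f = "\<lambda>m. ?s m (Poly_Mapping.lookup f m)" and ?g = "\<lambda>n. ?s n (Poly_Mapping.lookup g n)"
  have "f * g = (\<Sum>m\<in>Poly_Mapping.keys f. \<Sum>n\<in>Poly_Mapping.keys g. ?f m * ?g n)"
    by (simp add: sum_singles flip: sum_product)
  then have "partial_deriv i (f * g) = (\<Sum>m\<in>Poly_Mapping.keys f. \<Sum>n\<in>Poly_Mapping.keys g.
      partial_deriv i (?f m) * ?g n + ?f m * partial_deriv i (?g n))"
    by (simp only: partial_deriv_sum single)
  also have "\<dots> = partial_deriv i f * g + f * partial_deriv i g"
    by (simp only: sum.distrib sum_singles flip: sum_product partial_deriv_sum)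
  finally show ?thesis .
qed

text \<open>\<open>D\<close> is any derivation of the target that kills the scalars;
  \<open>pderiv\<close> and coefficientwise \<open>pderiv\<close> are the instances used for lines
  and planes.\<close>

lemma (in scalars) subst_chain_rule:
  assumes "\<And>c. D (\<iota> c) = 0" "\<And>a b. D (a + b) = D a + D b" "\<And>a b. D (a * b) = D a * b + a * D b"
  shows "D (subst \<iota> \<theta> f) = (\<Sum>i\<in>UNIV. D (\<theta> i) * subst \<iota> \<theta> (partial_deriv i f))"
proof (induction f rule: poly4_induct)
  case (Var j)
  have "D (\<theta> i) * subst \<iota> \<theta> (partial_deriv i (Var j)) = (if i = j then D (\<theta> i) else 0)" for i
    by (simp add: partial_deriv_Var subst_simps)
  then show ?case
    by (simp add: subst_simps)
qed (simp_all add: subst_simps assms partial_deriv_Const partial_deriv_add partial_deriv_mult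
    sum.distrib sum_distrib_left sum_distrib_right algebra_simps)

section \<open>Directional derivatives and restriction to lines\<close>

definition dir_deriv :: "complex ^ coord \<Rightarrow> poly4 \<Rightarrow> poly4" where
  "dir_deriv u f = (\<Sum>i\<in>UNIV. Const (u $ i) * partial_deriv i f)"

lemma dir_deriv_add: "dir_deriv u (f + g) = dir_deriv u f + dir_deriv u g"
  by (simp add: dir_deriv_def partial_deriv_add distrib_left sum.distrib)

lemma dir_deriv_0: "dir_deriv u 0 = 0"
  by (simp add: dir_deriv_def partial_deriv_0)

lemma dir_deriv_sum: "dir_deriv u (sum F A) = (\<Sum>a\<in>A. dir_deriv u (F a))"
  by (induction A rule: infinite_finite_induct) (simp_all add: dir_deriv_add dir_deriv_0)

lemma dir_deriv_mult: "dir_deriv u (f * g) = dir_deriv u f * g + f * dir_deriv u g"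
proof -
  have "dir_deriv u (f * g) = (\<Sum>i\<in>UNIV.
      Const (u $ i) * partial_deriv i f * g + f * (Const (u $ i) * partial_deriv i g))"
    unfolding dir_deriv_def by (intro sum.cong) (simp_all only: partial_deriv_mult distrib_left ac_simps)
  then show ?thesis
    by (simp only: dir_deriv_def sum.distrib flip: sum_distrib_left sum_distrib_right)
qed

lemma dir_deriv_Const: "dir_deriv u (Const c) = 0"
  by (simp add: dir_deriv_def partial_deriv_Const)

lemma dir_deriv_Var: "dir_deriv u (Var i) = Const (u $ i)"
  by (cases i) (simp_all add: dir_deriv_def partial_deriv_Var sum_coord)

lemma poly_eval_dir_deriv: "poly_eval (dir_deriv u f) v = (\<Sum>i\<in>UNIV. u $ i * poly_eval (partial_deriv i f) v)"
  by (simp add: dir_deriv_def poly_eval_simps)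

text \<open>This is f(p + s u) as a formal polynomial in s, with degree, coefficients and roots at
  hand.\<close>

definition on_line :: "complex ^ coord \<Rightarrow> complex ^ coord \<Rightarrow> poly4 \<Rightarrow> complex poly" where
  "on_line p u = subst (\<lambda>c. [:c:]) (\<lambda>i. [:p $ i, u $ i:])"

interpretation line: scalars "\<lambda>c :: complex. [:c:]"
  by standard (simp_all add: one_pCons)

lemmas on_line_simps = line.subst_simps[of "\<lambda>i. [:p $ i, u $ i:]" for p u, folded on_line_def]

lemma poly_on_line: "poly (on_line p u f) s = poly_eval f (p + s *s u)"
  by (induction f rule: poly4_induct) (simp_all add: on_line_simps poly_eval_simps)

lemma pderiv_on_line: "pderiv (on_line p u f) = on_line p u (dir_deriv u f)"
proof -
  have "pderiv (on_line p u f) = (\<Sum>i\<in>UNIV. pderiv [:p $ i, u $ i:] * on_line p u (partial_deriv i f))"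
    unfolding on_line_def by (rule line.subst_chain_rule) (simp_all add: pderiv_add pderiv_mult)
  then show ?thesis
    by (simp add: dir_deriv_def on_line_simps pderiv_pCons)
qed

lemma partial_deriv_eq_dir_deriv: "partial_deriv i f = dir_deriv (axis i 1) f"
  by (cases i) (simp_all add: dir_deriv_def sum_coord axis_def Const_1 Const.\<iota>_0)

lemma lookup_partial_deriv:
  "Poly_Mapping.lookup (partial_deriv i f) m =
    of_nat (Suc (Poly_Mapping.lookup m i)) * Poly_Mapping.lookup f (m + Poly_Mapping.single i 1)"
proof -
  let ?e = "Poly_Mapping.single i (1 :: nat)"
  have iff: "n - ?e = m \<longleftrightarrow> n = m + ?e" if "Poly_Mapping.lookup n i \<noteq> 0" for n
  proof
    assume "n - ?e = m"
    then have m: "m = n - ?e"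
      by simp
    show "n = m + ?e"
      using that by (intro poly_mapping_eqI) (auto simp: m lookup_add lookup_minus lookup_single when_def)
  qed simp
  have "Poly_Mapping.lookup (partial_deriv i f) m = (\<Sum>n\<in>Poly_Mapping.keys f.
      of_nat (Poly_Mapping.lookup n i) * Poly_Mapping.lookup f n when n - ?e = m)"
    by (simp add: partial_deriv_def lookup_sum lookup_single)
  also have "\<dots> = (\<Sum>n\<in>Poly_Mapping.keys f.
      if n = m + ?e then of_nat (Poly_Mapping.lookup n i) * Poly_Mapping.lookup f n else 0)"
  proof (rule sum.cong)
    fix n
    show "(of_nat (Poly_Mapping.lookup n i) * Poly_Mapping.lookup f n when n - ?e = m) =
      (if n = m + ?e then of_nat (Poly_Mapping.lookup n i) * Poly_Mapping.lookup f n else 0)"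
      using iff[of n] by (cases "Poly_Mapping.lookup n i = 0") (auto simp: when_def)
  qed simp
  also have "\<dots> = of_nat (Suc (Poly_Mapping.lookup m i)) * Poly_Mapping.lookup f (m + ?e)"
    by (simp add: sum.delta in_keys_iff lookup_add)
  finally show ?thesis .
qed

lemma mon_degree_add: "mon_degree (m + n) = mon_degree m + mon_degree n"
  by (simp add: mon_degree_def lookup_add sum.distrib)

lemma mon_degree_single: "mon_degree (Poly_Mapping.single i n) = n"
  by (cases i) (simp_all add: mon_degree_def lookup_single sum_coord)

text \<open>Induction on a strict degree bound. Vanishing along all coordinate lines passes to the
  partial derivatives, which are 0 by induction; in characteristic 0 only the constant term can
  remain, and it is a value of \<open>f\<close>.\<close>

lemma poly_eval_eq_0_imp:
  assumes "\<And>v. poly_eval f v = 0"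
  shows "f = 0"
proof -
  have "\<forall>f. (\<forall>m\<in>Poly_Mapping.keys f. mon_degree m < n) \<longrightarrow> (\<forall>v. poly_eval f v = 0) \<longrightarrow> f = 0" for n
  proof (induction n)
    case 0
    then show ?case
      by (metis keys_eq_empty less_nat_zero_code equals0I)
  next
    case (Suc n)
    show ?case
    proof (intro allI impI)
      fix f assume deg: "\<forall>m\<in>Poly_Mapping.keys f. mon_degree m < Suc n" and van: "\<forall>v. poly_eval f v = 0"
      have "partial_deriv i f = 0" for i
      proof -
        have "poly_eval (partial_deriv i f) v = 0" for v
        proof -
          have "poly (on_line v (axis i 1) f) s = 0" for s
            using van by (simp add: poly_on_line)
          then have "on_line v (axis i 1) f = 0"
            using poly_all_0_iff_0 by blast
          then have "on_line v (axis i 1) (partial_deriv i f) = 0"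
            using pderiv_on_line[of v "axis i 1" f] by (simp add: partial_deriv_eq_dir_deriv)
          then show ?thesis
            using poly_on_line[of v "axis i 1" "partial_deriv i f" 0] by simp
        qed
        moreover have "mon_degree m < n" if "m \<in> Poly_Mapping.keys (partial_deriv i f)" for m
        proof -
          have "m + Poly_Mapping.single i 1 \<in> Poly_Mapping.keys f"
            using that by (auto simp: in_keys_iff lookup_partial_deriv)
          then show ?thesis
            using deg by (fastforce simp: mon_degree_add mon_degree_single)
        qed
        ultimately show ?thesis
          using Suc.IH by blast
      qed
      then have "Poly_Mapping.lookup f (m + Poly_Mapping.single i 1) = 0" for m i
        using lookup_partial_deriv[of i f m] by simp (metis of_nat_Suc of_nat_neq_0 mult_eq_0_iff)
      moreover have "m - Poly_Mapping.single i 1 + Poly_Mapping.single i 1 = m"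
        if "Poly_Mapping.lookup m i \<noteq> 0" for m :: "coord \<Rightarrow>\<^sub>0 nat" and i
        using that by (intro poly_mapping_eqI) (auto simp: lookup_add lookup_minus lookup_single when_def)
      ultimately have "Poly_Mapping.lookup f m = 0" if "m \<noteq> 0" for m
        using that by (metis poly_mapping_eqI lookup_zero)
      then have "f = Const (Poly_Mapping.lookup f 0)"
        by (intro poly_mapping_eqI) (auto simp: Const_def lookup_single when_def)
      moreover from this have "Poly_Mapping.lookup f 0 = 0"
        using van poly_eval_simps(6) by metis
      ultimately show "f = 0"
        by (simp add: Const_def)
    qed
  qed
  moreover obtain n where "\<forall>m\<in>Poly_Mapping.keys f. mon_degree m < n"
    using finite_nat_set_iff_bounded[of "mon_degree ` Poly_Mapping.keys f"] by auto
  ultimately show ?thesis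
    using assms by blast
qed

lemma poly_eq_iff_poly_eval: "f = g \<longleftrightarrow> (\<forall>v. poly_eval f v = poly_eval g v)"
  using poly_eval_eq_0_imp[of "f - g"] by (auto simp: poly_eval_simps)

lemma ex_poly_eval_nonzero: "f \<noteq> 0 \<Longrightarrow> \<exists>v. poly_eval f v \<noteq> 0"
  using poly_eval_eq_0_imp by blast

section \<open>Homogeneous polynomials\<close>

lemma homogeneous_0: "homogeneous k 0"
  by (simp add: homogeneous_def)

lemma homogeneous_add: "homogeneous k f \<Longrightarrow> homogeneous k g \<Longrightarrow> homogeneous k (f + g)"
  unfolding homogeneous_def using keys_add[of f g] by blast

lemma homogeneous_sum: "(\<And>a. a \<in> A \<Longrightarrow> homogeneous k (F a)) \<Longrightarrow> homogeneous k (sum F A)"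
  by (induction A rule: infinite_finite_induct) (simp_all add: homogeneous_0 homogeneous_add)

lemma homogeneous_mult: "homogeneous k f \<Longrightarrow> homogeneous l g \<Longrightarrow> homogeneous (k + l) (f * g)"
  unfolding homogeneous_def using keys_mult[of f g] by (fastforce simp: mon_degree_add)

lemma homogeneous_Const: "homogeneous 0 (Const c)"
  by (simp add: homogeneous_def Const_def mon_degree_def)

lemma homogeneous_power: "homogeneous k f \<Longrightarrow> homogeneous (n * k) (f ^ n)"
proof (induction n)
  case 0
  then show ?case
    using homogeneous_Const[of 1] by (simp add: Const_1)
qed (simp add: homogeneous_mult)

lemma homogeneous_Var: "homogeneous 1 (Var i)"
  by (simp add: homogeneous_def Var_def mon_degree_single)

lemma homogeneous_linear_poly: "homogeneous 1 (linear_poly c)"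
  unfolding linear_poly_def
  using homogeneous_mult[OF homogeneous_Const homogeneous_Var] by (auto intro: homogeneous_sum)

lemma homogeneous_uminus: "homogeneous k f \<Longrightarrow> homogeneous k (- f)"
  using homogeneous_mult[OF homogeneous_Const[of "-1"]] by (simp add: Const_def single_uminus)

lemma homogeneous_diff: "homogeneous k f \<Longrightarrow> homogeneous k g \<Longrightarrow> homogeneous k (f - g)"
  using homogeneous_add[OF _ homogeneous_uminus] by fastforce

lemma degree_on_line:
  assumes "homogeneous k f"
  shows "degree (on_line p u f) \<le> k"
  unfolding on_line_def subst_def
proof (rule degree_sum_le)
  fix m assume m: "m \<in> Poly_Mapping.keys f"
  have linear: "degree ([:a, b:] ^ n) \<le> n" for a b :: complex and n
    using degree_power_le[of "[:a, b:]" n] by (simp split: if_splits)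
  have "degree (\<Prod>i\<in>UNIV. [:p $ i, u $ i:] ^ Poly_Mapping.lookup m i)
      \<le> (\<Sum>i\<in>UNIV. degree ([:p $ i, u $ i:] ^ Poly_Mapping.lookup m i))"
    using degree_prod_sum_le[of UNIV "\<lambda>i. [:p $ i, u $ i:] ^ Poly_Mapping.lookup m i"]
    by (simp add: comp_def)
  also have "\<dots> \<le> mon_degree m"
    unfolding mon_degree_def by (intro sum_mono linear)
  also have "mon_degree m = k"
    using assms m by (simp add: homogeneous_def)
  finally have "degree (smult (Poly_Mapping.lookup f m)
      (\<Prod>i\<in>UNIV. [:p $ i, u $ i:] ^ Poly_Mapping.lookup m i)) \<le> k"
    using degree_smult_le order_trans by blast
  then show "degree ([:Poly_Mapping.lookup f m:] *
      (\<Prod>i\<in>UNIV. [:p $ i, u $ i:] ^ Poly_Mapping.lookup m i)) \<le> k"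
    by simp
qed simp

section \<open>Algebraic dependence from vanishing Jacobian minors\<close>

text \<open>Gaussian elimination: a pivot row \<open>b\<close> clears column \<open>N\<close> from
  the other rows, and induction handles the remaining columns.\<close>

lemma exists_linear_relation:
  fixes M :: "'b \<Rightarrow> nat \<Rightarrow> 'a::field"
  assumes "finite A" "card A > N"
  shows "\<exists>c. (\<exists>a\<in>A. c a \<noteq> 0) \<and> (\<forall>j<N. (\<Sum>a\<in>A. c a * M a j) = 0)"
  using assms
proof (induction N arbitrary: A M)
  case 0
  then obtain a where "a \<in> A"
    by fastforce
  then show ?case
    by (intro exI[of _ "\<lambda>_. 1"]) auto
next
  case (Suc N)
  show ?case
  proof (cases "\<forall>a\<in>A. M a N = 0")
    case True
    then show ?thesis
      using Suc.IH[of A M] Suc.prems by (force simp: less_Suc_eq)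
  next
    case False
    then obtain b where b: "b \<in> A" "M b N \<noteq> 0"
      by blast
    let ?M = "\<lambda>a j. M a j - M a N / M b N * M b j"
    have "finite (A - {b})" "card (A - {b}) > N"
      using Suc.prems b by auto
    then obtain c where c: "\<exists>a\<in>A - {b}. c a \<noteq> 0" "\<forall>j<N. (\<Sum>a\<in>A - {b}. c a * ?M a j) = 0"
      using Suc.IH[of "A - {b}" ?M] by blast
    define d where "d = c(b := - (\<Sum>a\<in>A - {b}. c a * (M a N / M b N)))"
    have split: "(\<Sum>a\<in>A. d a * M a j) = (\<Sum>a\<in>A - {b}. c a * ?M a j)" for j
    proof -
      have "(\<Sum>a\<in>A. d a * M a j) = d b * M b j + (\<Sum>a\<in>A - {b}. d a * M a j)"
        using b Suc.prems by (simp add: sum.remove)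
      also have "(\<Sum>a\<in>A - {b}. d a * M a j) = (\<Sum>a\<in>A - {b}. c a * M a j)"
        by (intro sum.cong) (auto simp: d_def)
      finally show ?thesis
        by (simp add: d_def sum_distrib_right right_diff_distrib sum_subtractf mult.assoc)
    qed
    have "(\<Sum>a\<in>A. d a * M a j) = 0" if "j < Suc N" for j
    proof (cases "j = N")
      case True
      have "?M a N = 0" for a
        using b by simp
      then show ?thesis
        unfolding split True by (metis (no_types, lifting) mult_zero_right sum.neutral)
    next
      case False
      then show ?thesis
        using that c(2) unfolding split by simp
    qed
    moreover have "\<exists>a\<in>A. d a \<noteq> 0"
      using c(1) by (auto simp: d_def)
    ultimately show ?thesis
      by blast
  qed
qed

section \<open>Linear forms and restriction to planes\<close>

lemma poly_eval_linear_poly: "poly_eval (linear_poly c) v = (\<Sum>i\<in>UNIV. c $ i * v $ i)"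
  by (simp add: linear_poly_def poly_eval_simps)

lemma poly_eval_linear_poly_add:
  "poly_eval (linear_poly c) (u + v) = poly_eval (linear_poly c) u + poly_eval (linear_poly c) v"
  by (simp add: poly_eval_linear_poly sum.distrib distrib_left)

lemma poly_eval_linear_poly_diff:
  "poly_eval (linear_poly c) (u - v) = poly_eval (linear_poly c) u - poly_eval (linear_poly c) v"
  by (simp add: poly_eval_linear_poly sum_subtractf right_diff_distrib)

lemma poly_eval_linear_poly_scale:
  "poly_eval (linear_poly c) (a *s v) = a * poly_eval (linear_poly c) v"
  using poly_eval_scale[OF homogeneous_linear_poly] by simp

lemma poly_eval_linear_poly_axis: "poly_eval (linear_poly c) (axis i a) = c $ i * a"
  by (cases i) (simp_all add: poly_eval_linear_poly sum_coord axis_def)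

lemma linear_poly_eq_0_iff: "linear_poly c = 0 \<longleftrightarrow> c = 0"
proof
  assume "linear_poly c = 0"
  then have "c $ i = 0" for i
    using poly_eval_linear_poly_axis[of c i 1] by (simp add: poly_eval_0)
  then show "c = 0"
    by (simp add: vec_eq_iff)
qed (simp add: linear_poly_def Const.\<iota>_0)

lemma dir_deriv_linear_poly: "dir_deriv u (linear_poly c) = Const (poly_eval (linear_poly c) u)"
proof -
  have "dir_deriv u (linear_poly c) = (\<Sum>i\<in>UNIV. Const (c $ i * u $ i))"
    by (simp add: linear_poly_def dir_deriv_sum dir_deriv_mult dir_deriv_Const dir_deriv_Var Const_mult)
  then show ?thesis
    by (simp add: poly_eval_linear_poly sum_coord Const_add)
qed

text \<open>This is f(p + s w + t u) with t as the outer variable, so that the coefficients in t are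
  functions on the line through \<open>p\<close> in direction \<open>w\<close>.
  \<open>pderiv\<close> differentiates in t, \<open>map_poly pderiv\<close> in s.\<close>

definition on_plane :: "complex ^ coord \<Rightarrow> complex ^ coord \<Rightarrow> complex ^ coord \<Rightarrow> poly4 \<Rightarrow> complex poly poly" where
  "on_plane p w u = subst (\<lambda>c. [:[:c:]:]) (\<lambda>i. [:[:p $ i, w $ i:], [:u $ i:]:])"

interpretation plane: scalars "\<lambda>c :: complex. [:[:c:]:]"
  by standard (simp_all add: one_pCons)

lemmas on_plane_simps =
  plane.subst_simps[of "\<lambda>i. [:[:p $ i, w $ i:], [:u $ i:]:]" for p w u, folded on_plane_def]

lemma poly_on_plane: "poly (poly (on_plane p w u f) [:t:]) s = poly_eval f (p + s *s w + t *s u)"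
  by (induction f rule: poly4_induct)
    (simp_all add: on_plane_simps poly_eval_simps del: mult_pCons_left mult_pCons_right)

lemma coeff_on_plane_0: "coeff (on_plane p w u f) 0 = on_line p w f"
  by (induction f rule: poly4_induct) (simp_all add: on_plane_simps on_line_simps coeff_mult_0)

lemma pderiv_on_plane: "pderiv (on_plane p w u f) = on_plane p w u (dir_deriv u f)"
proof -
  have "pderiv (on_plane p w u f) =
      (\<Sum>i\<in>UNIV. pderiv [:[:p $ i, w $ i:], [:u $ i:]:] * on_plane p w u (partial_deriv i f))"
    unfolding on_plane_def by (rule plane.subst_chain_rule) (simp_all add: pderiv_add pderiv_mult)
  then show ?thesis
    by (simp add: dir_deriv_def on_plane_simps pderiv_pCons)
qed

lemma map_pderiv_on_plane: "map_poly pderiv (on_plane p w u f) = on_plane p w u (dir_deriv w f)"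
proof -
  have add: "map_poly pderiv (a + b) = map_poly pderiv a + map_poly pderiv b" for a b :: "complex poly poly"
    by (rule poly_eqI) (simp add: coeff_map_poly pderiv_add)
  have pderiv_sum: "pderiv (sum F A) = (\<Sum>x\<in>A. pderiv (F x))" for F :: "nat \<Rightarrow> complex poly" and A
    by (induction A rule: infinite_finite_induct) (simp_all add: pderiv_add)
  have mult: "map_poly pderiv (a * b) = map_poly pderiv a * b + a * map_poly pderiv b"
    for a b :: "complex poly poly"
    by (rule poly_eqI) (simp add: coeff_map_poly coeff_mult pderiv_sum pderiv_mult sum.distrib
        add.commute mult.commute[of _ "pderiv _"])
  have "map_poly pderiv (on_plane p w u f) = (\<Sum>i\<in>UNIV.
      map_poly pderiv [:[:p $ i, w $ i:], [:u $ i:]:] * on_plane p w u (partial_deriv i f))"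
    unfolding on_plane_def
    by (rule plane.subst_chain_rule) (simp_all add: add mult map_poly_pCons)
  then show ?thesis
    by (simp add: dir_deriv_def on_plane_simps map_poly_pCons pderiv_pCons)
qed

text \<open>Along the plane \<open>F(s,t) = f(p + s w + t u)\<close> satisfies \<open>G\<^sub>s F\<^sub>t = G\<^sub>t F\<^sub>s\<close>. If \<open>t\<^sup>m F\<^sub>m(s)\<close> with
  \<open>m > 0\<close> were the lowest term of \<open>F\<close> in \<open>t\<close>, the coefficient of \<open>t\<^bsup>m-1\<^esup>\<close> would give
  \<open>m G\<^sub>s(s,0) F\<^sub>m(s) = 0\<close>.\<close>

lemma vanish_on_plane:
  assumes rel: "dir_deriv w g * dir_deriv u f = dir_deriv u g * dir_deriv w f"
    and line: "on_line p w f = 0" and nz: "on_line p w (dir_deriv w g) \<noteq> 0"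
  shows "poly_eval f (p + s *s w + t *s u) = 0"
proof -
  let ?F = "on_plane p w u f" and ?Gs = "on_plane p w u (dir_deriv w g)"
    and ?Gt = "on_plane p w u (dir_deriv u g)"
  have rel': "?Gs * pderiv ?F = ?Gt * map_poly pderiv ?F"
    using rel by (simp only: pderiv_on_plane map_pderiv_on_plane flip: on_plane_simps(9))
  have "?F = 0"
  proof (rule ccontr)
    assume "?F \<noteq> 0"
    then have ex: "\<exists>n. coeff ?F n \<noteq> 0"
      by (meson leading_coeff_0_iff)
    define m where "m = (LEAST n. coeff ?F n \<noteq> 0)"
    have m: "coeff ?F m \<noteq> 0"
      unfolding m_def by (rule LeastI_ex) (rule ex)
    have below: "coeff ?F n = 0" if "n < m" for n
      using that not_less_Least unfolding m_def by blast
    have "m \<noteq> 0"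
      using m line coeff_on_plane_0 by metis
    then obtain j where j: "m = Suc j"
      using not0_implies_Suc by blast
    have "coeff (?Gt * map_poly pderiv ?F) j = 0"
      unfolding coeff_mult by (rule sum.neutral) (simp add: coeff_map_poly below j)
    moreover have "coeff (?Gs * pderiv ?F) j = coeff ?Gs 0 * coeff (pderiv ?F) j"
    proof -
      have "coeff ?Gs i * coeff (pderiv ?F) (j - i) = 0" if "i \<in> {..j} - {0}" for i
        using that below[of "Suc (j - i)"] by (simp add: coeff_pderiv j)
      then have "(\<Sum>i\<in>{..j} - {0}. coeff ?Gs i * coeff (pderiv ?F) (j - i)) = 0"
        by (rule sum.neutral[OF ballI])
      then show ?thesis
        unfolding coeff_mult by (subst sum.remove[of _ 0]) simp_all
    qed
    ultimately have "coeff ?Gs 0 * (of_nat m * coeff ?F m) = 0"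
      using rel' by (simp add: coeff_pderiv j)
    then show False
      using m nz \<open>m \<noteq> 0\<close> by (simp add: coeff_on_plane_0)
  qed
  then show ?thesis
    using poly_on_plane[of p w u f t s] by simp
qed

text \<open>A vector off ker \<ell> can be rescaled into the affine hyperplane p + ker \<ell>.
  Multiplying \<open>f\<close> by \<ell> takes care of the vectors in the kernel, and S is a
  domain.\<close>

lemma homogeneous_eq_0_if_vanishes_on_hyperplane:
  assumes hom: "homogeneous N f" and p: "poly_eval (linear_poly c) p \<noteq> 0"
    and van: "\<And>u. poly_eval (linear_poly c) u = 0 \<Longrightarrow> poly_eval f (p + u) = 0"
  shows "f = 0"
proof -
  let ?l = "poly_eval (linear_poly c)"
  have "poly_eval (f * linear_poly c) v = 0" for v
  proof (cases "?l v = 0")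
    case False
    let ?u = "(?l p / ?l v) *s v - p"
    have "?l ?u = 0"
      using False by (simp add: poly_eval_linear_poly_diff poly_eval_linear_poly_scale)
    then have "poly_eval f ((?l p / ?l v) *s v) = 0"
      using van[of ?u] by simp
    then show ?thesis
      using False p by (simp add: poly_eval_scale[OF hom] poly_eval_simps)
  qed (simp add: poly_eval_simps)
  then have "f * linear_poly c = 0"
    by (rule poly_eval_eq_0_imp)
  moreover have "linear_poly c \<noteq> 0"
    using p poly_eval_0 by metis
  ultimately show ?thesis
    by simp
qed

lemma poly_eval_translate:
  assumes "dir_deriv u f = 0"
  shows "poly_eval f (p + s *s u) = poly_eval f p"
proof -
  have "pderiv (on_line p u f) = 0"
    using assms by (simp add: pderiv_on_line on_line_simps)
  then have "degree (on_line p u f) = 0"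
    by (simp add: pderiv_eq_0_iff)
  then obtain b where "on_line p u f = [:b:]"
    by (rule degree_eq_zeroE)
  then show ?thesis
    using poly_on_line[of p u f 0] poly_on_line[of p u f s] by simp
qed

text \<open>A form of degree \<open>N\<close> whose differential is dependent on \<open>dg\<close> and \<open>d\<ell>\<close> is determined by its
  restriction to a line, so these forms span a space of dimension at most \<open>N + 1\<close>; but there are
  about \<open>N\<^sup>2 / 4k\<^sup>2\<close> monomials in \<open>g\<close>, \<open>h\<close>, \<open>\<ell>\<close> of degree \<open>N\<close>.\<close>

lemma exists_algebraic_relation:
  assumes "k \<ge> 1" "homogeneous k g" "homogeneous k h"
    and w: "poly_eval (linear_poly c) w = 0" "dir_deriv w g \<noteq> 0"
    and rel: "\<And>u. poly_eval (linear_poly c) u = 0 \<Longrightarrow>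
      dir_deriv w g * dir_deriv u h = dir_deriv u g * dir_deriv w h"
    and c: "c \<noteq> 0"
  shows "\<exists>n N \<gamma>. (\<exists>a<n. \<exists>b<n. \<gamma> a b \<noteq> (0 :: complex)) \<and>
    (\<Sum>a<n. \<Sum>b<n. Const (\<gamma> a b) * g ^ a * h ^ b * linear_poly c ^ (N - k * (a + b))) = 0"
proof -
  \<comment> \<open>A form of degree N on a line has at most N + 1 = 2kn + 1 coefficients, against
    n^2 = 2kn + n monomials, where n \<ge> 3. This N also ensures k (a + b) \<le> N, so that the
    exponent of \<ell> is not truncated.\<close>
  define n where "n = 2 * k + 1"
  define N where "N = 2 * k * n"
  define A where "A = {..<n} \<times> {..<n}"
  let ?l = "linear_poly c"
  define mono where "mono = (\<lambda>(a, b). g ^ a * h ^ b * ?l ^ (N - k * (a + b)))"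
  have N: "k * (a + b) \<le> N" if "(a, b) \<in> A" for a b
  proof -
    have "a + b \<le> 2 * n"
      using that by (auto simp: A_def)
    then have "k * (a + b) \<le> k * (2 * n)"
      by (rule mult_le_mono2)
    then show ?thesis
      by (simp add: N_def ac_simps)
  qed
  have hom: "homogeneous N (mono x)" if "x \<in> A" for x
  proof -
    obtain a b where x: "x = (a, b)"
      by (cases x)
    have "homogeneous (a * k + b * k + (N - k * (a + b)) * 1) (mono x)"
      unfolding mono_def x prod.case
      by (intro homogeneous_mult homogeneous_power homogeneous_linear_poly assms)
    moreover have "a * k + b * k + (N - k * (a + b)) * 1 = N"
      using N[of a b] that x by (simp add: algebra_simps)
    ultimately show ?thesis
      by simp
  qed
  \<comment> \<open>The first factor makes D_w g nonzero on the line through \<open>p\<close>, as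
    \<open>vanish_on_plane\<close> requires; the second puts p + ker \<ell> off the origin, so that
    it determines a form.\<close>
  obtain p where p: "poly_eval (dir_deriv w g * ?l) p \<noteq> 0"
    using ex_poly_eval_nonzero[of "dir_deriv w g * ?l"] w(2) c linear_poly_eq_0_iff by auto
  have "card A = n * n"
    by (simp add: A_def)
  then have "card A > Suc N"
    using assms(1) by (simp add: n_def N_def algebra_simps)
  then obtain \<gamma> where \<gamma>: "\<exists>x\<in>A. \<gamma> x \<noteq> 0"
      "\<forall>j<Suc N. (\<Sum>x\<in>A. \<gamma> x * coeff (on_line p w (mono x)) j) = 0"
    using exists_linear_relation[of A "Suc N" "\<lambda>x j. coeff (on_line p w (mono x)) j"]
    by (auto simp: A_def)
  define f where "f = (\<Sum>x\<in>A. Const (\<gamma> x) * mono x)"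
  have hom_f: "homogeneous N f"
    unfolding f_def using homogeneous_mult[OF homogeneous_Const hom] by (auto intro: homogeneous_sum)
  have line: "on_line p w f = 0"
  proof (rule poly_eqI)
    fix j
    show "coeff (on_line p w f) j = coeff 0 j"
    proof (cases "j < Suc N")
      case True
      then show ?thesis
        using \<gamma>(2) by (simp add: f_def on_line_simps coeff_sum)
    next
      case False
      then have "degree (on_line p w f) < j"
        using degree_on_line[OF hom_f, of p w] by linarith
      then show ?thesis
        by (simp add: coeff_eq_0)
    qed
  qed
  have vanish: "poly_eval f (p + u) = 0" if u: "poly_eval ?l u = 0" for u
  proof -
    \<comment> \<open>The condition is inherited by products (Leibniz) and by linear combinations,
      so it passes from g, h, \<ell> to \<open>f\<close>. For \<ell> both derivatives vanish, since
      \<open>u\<close> and \<open>w\<close> lie in its kernel.\<close>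
    define S where "S = {f. dir_deriv w g * dir_deriv u f = dir_deriv u g * dir_deriv w f}"
    have mult: "a * b \<in> S" if "a \<in> S" "b \<in> S" for a b
    proof -
      have "dir_deriv w g * dir_deriv u (a * b)
          = (dir_deriv w g * dir_deriv u a) * b + a * (dir_deriv w g * dir_deriv u b)"
        by (simp only: dir_deriv_mult distrib_left ac_simps)
      also have "\<dots> = dir_deriv u g * dir_deriv w (a * b)"
        using that by (simp only: S_def mem_Collect_eq dir_deriv_mult distrib_left ac_simps)
      finally show ?thesis
        by (simp add: S_def)
    qed
    have const: "Const a \<in> S" for a
      by (simp add: S_def dir_deriv_Const)
    have pow: "a ^ n \<in> S" if "a \<in> S" for a n
      using const[of 1] by (induction n) (auto intro: mult that simp: Const_1)
    have "g \<in> S" "h \<in> S" "?l \<in> S"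
      using rel[OF u] w(1) u by (simp_all add: S_def dir_deriv_linear_poly Const.\<iota>_0)
    then have "Const (\<gamma> x) * mono x \<in> S" for x
      unfolding mono_def by (cases x) (auto intro: mult const pow)
    then have "f \<in> S"
      by (simp add: S_def f_def dir_deriv_sum sum_distrib_left)
    moreover have "on_line p w (dir_deriv w g) \<noteq> 0"
    proof
      assume "on_line p w (dir_deriv w g) = 0"
      then show False
        using p poly_on_line[of p w "dir_deriv w g" 0] by (simp add: poly_eval_simps)
    qed
    ultimately show ?thesis
      using vanish_on_plane[of w g u f p 0 1] line by (simp add: S_def)
  qed
  have "poly_eval ?l p \<noteq> 0"
    using p by (simp add: poly_eval_simps)
  then have "f = 0"
    by (rule homogeneous_eq_0_if_vanishes_on_hyperplane[OF hom_f]) (rule vanish)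
  moreover have "f = (\<Sum>a<n. \<Sum>b<n. Const (\<gamma> (a, b)) * g ^ a * h ^ b * ?l ^ (N - k * (a + b)))"
    unfolding f_def mono_def A_def sum.cartesian_product
    by (intro sum.cong) (simp_all only: split_beta prod.collapse ac_simps)
  ultimately show ?thesis
    using \<gamma>(1) by (intro exI[of _ n] exI[of _ N] exI[of _ "\<lambda>a b. \<gamma> (a, b)"]) (auto simp: A_def)
qed

section \<open>Cancelling powers of g and h in the relation\<close>

lemma span_pair_iff: "x \<in> ideal.span {g, h} \<longleftrightarrow> (\<exists>a b. x = a * g + b * h)"
  by (auto simp: ideal.span_breakdown_eq algebra_simps)

text \<open>Once the lowest power is divided out, everything except the lowest coefficient is
  divisible by \<open>x\<close>. Applied with x = g and with x = h.\<close>

lemma sum_powers_factor: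
  fixes x :: "'a::comm_ring_1"
  assumes "a0 < n" "\<And>a. a < a0 \<Longrightarrow> Q a = 0"
  shows "\<exists>X. (\<Sum>a<n. x ^ a * Q a) = x ^ a0 * (Q a0 + x * X)"
proof -
  have "{..<n} = {..<a0} \<union> {a0} \<union> {a0<..<n}"
    using assms(1) by auto
  then have "(\<Sum>a<n. x ^ a * Q a) = (\<Sum>a\<in>{..<a0} \<union> {a0} \<union> {a0<..<n}. x ^ a * Q a)"
    by simp
  also have "\<dots> = (\<Sum>a<a0. x ^ a * Q a) + x ^ a0 * Q a0 + (\<Sum>a\<in>{a0<..<n}. x ^ a * Q a)"
    by (subst sum.union_disjoint) auto
  also have "(\<Sum>a<a0. x ^ a * Q a) = 0"
    using assms(2) by (intro sum.neutral) simp
  also have "(\<Sum>a\<in>{a0<..<n}. x ^ a * Q a) = (\<Sum>a\<in>{a0<..<n}. x ^ a0 * (x * (x ^ (a - a0 - 1) * Q a)))"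
  proof (rule sum.cong)
    fix a assume "a \<in> {a0<..<n}"
    then have "a = a0 + Suc (a - a0 - 1)"
      by auto
    then have "x ^ a = x ^ a0 * (x * x ^ (a - a0 - 1))"
      by (metis power_add power_Suc)
    then show "x ^ a * Q a = x ^ a0 * (x * (x ^ (a - a0 - 1) * Q a))"
      by (simp add: mult.assoc)
  qed simp
  also have "0 + x ^ a0 * Q a0 + \<dots> = x ^ a0 * (Q a0 + x * (\<Sum>a\<in>{a0<..<n}. x ^ (a - a0 - 1) * Q a))"
    by (simp add: distrib_left sum_distrib_left)
  finally show ?thesis
    by blast
qed

text \<open>Let (a0, b0) be lexicographically least among the exponents that occur. Dividing by
  \<open>g ^ a0\<close> shows that g divides \<open>Q a0\<close>, and cancelling
  \<open>h ^ b0\<close> modulo g leaves a nonzero constant times a power of \<ell> plus a multiple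
  of h. If all derivatives of g along ker \<ell> vanish, g is a constant times
  \<open>\<ell> ^ k\<close>.\<close>

lemma linear_power_in_ideal:
  assumes "k \<ge> 1" "g \<noteq> 0" "homogeneous k g" "homogeneous k h" "c \<noteq> 0"
    and rel: "\<And>u w. poly_eval (linear_poly c) u = 0 \<Longrightarrow> poly_eval (linear_poly c) w = 0 \<Longrightarrow>
      dir_deriv w g * dir_deriv u h = dir_deriv u g * dir_deriv w h"
    and nzd: "\<And>q. g dvd h * q \<Longrightarrow> g dvd q"
  shows "\<exists>e. linear_poly c ^ e \<in> ideal.span {g, h}"
proof (cases "\<exists>w. poly_eval (linear_poly c) w = 0 \<and> dir_deriv w g \<noteq> 0")
  case True
  let ?l = "linear_poly c"
  from True obtain w where w: "poly_eval ?l w = 0" "dir_deriv w g \<noteq> 0"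
    by blast
  from exists_algebraic_relation[OF assms(1,3,4) w rel[OF _ w(1)] assms(5)]
  obtain n N \<gamma> where ex: "\<exists>a<n. \<exists>b<n. \<gamma> a b \<noteq> (0 :: complex)"
    and sum: "(\<Sum>a<n. \<Sum>b<n. Const (\<gamma> a b) * g ^ a * h ^ b * ?l ^ (N - k * (a + b))) = 0"
    by blast
  define Q where "Q = (\<lambda>a. \<Sum>b<n. h ^ b * (Const (\<gamma> a b) * ?l ^ (N - k * (a + b))))"
  define a0 where "a0 = (LEAST a. a < n \<and> (\<exists>b<n. \<gamma> a b \<noteq> 0))"
  have a0: "a0 < n" "\<exists>b<n. \<gamma> a0 b \<noteq> 0"
    unfolding a0_def by (rule LeastI2_ex, use ex in blast, blast)+
  have zero: "\<gamma> a b = 0" if "a < a0" "b < n" for a b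
    using not_less_Least[OF that(1)[unfolded a0_def]] that a0(1) by auto
  have "(\<Sum>a<n. g ^ a * Q a) = 0"
    using sum by (simp only: Q_def sum_distrib_left ac_simps)
  moreover have "Q a = 0" if "a < a0" for a
    unfolding Q_def by (rule sum.neutral) (simp add: zero[OF that] Const.\<iota>_0)
  ultimately obtain X where "g ^ a0 * (Q a0 + g * X) = 0"
    using sum_powers_factor[OF a0(1), of Q g] by metis
  then have "Q a0 = g * (- X)"
    using assms(2) by (simp add: eq_neg_iff_add_eq_0)
  then have dvd: "g dvd Q a0"
    by (rule dvdI)
  define b0 where "b0 = (LEAST b. b < n \<and> \<gamma> a0 b \<noteq> 0)"
  have b0: "b0 < n" "\<gamma> a0 b0 \<noteq> 0"
    unfolding b0_def by (rule LeastI2_ex, use a0 in blast, blast)+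
  have "Const (\<gamma> a0 b) * ?l ^ (N - k * (a0 + b)) = 0" if "b < b0" for b
    using not_less_Least[OF that[unfolded b0_def]] that b0(1) by (simp add: Const.\<iota>_0)
  then obtain Y where Y: "Q a0 = h ^ b0 * (Const (\<gamma> a0 b0) * ?l ^ (N - k * (a0 + b0)) + h * Y)"
    using sum_powers_factor[OF b0(1), of "\<lambda>b. Const (\<gamma> a0 b) * ?l ^ (N - k * (a0 + b))" h]
    unfolding Q_def by blast
  have cancel: "g dvd r" if "g dvd h ^ m * r" for m r
    using that
  proof (induction m)
    case (Suc m)
    then show ?case
      using nzd[of "h ^ m * r"] by (simp only: power_Suc mult.assoc)
  qed simp
  obtain Z where Z: "Const (\<gamma> a0 b0) * ?l ^ (N - k * (a0 + b0)) + h * Y = g * Z"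
    using cancel[OF dvd[unfolded Y]] by (rule dvdE)
  have "Z * g \<in> ideal.span {g, h}" "Y * h \<in> ideal.span {g, h}"
    by (rule ideal.span_scale, rule ideal.span_base, simp)+
  then have "Const (1 / \<gamma> a0 b0) * (g * Z - h * Y) \<in> ideal.span {g, h}"
    unfolding mult.commute[of g] mult.commute[of h] by (rule ideal.span_scale[OF ideal.span_diff])
  moreover have "?l ^ (N - k * (a0 + b0)) = Const (1 / \<gamma> a0 b0) * (g * Z - h * Y)"
  proof -
    have "?l ^ (N - k * (a0 + b0)) = Const (1 / \<gamma> a0 b0 * \<gamma> a0 b0) * ?l ^ (N - k * (a0 + b0))"
      using b0(2) by (simp add: Const_1)
    then show ?thesis
      by (simp only: Const_mult mult.assoc add_diff_cancel_right' flip: Z)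
  qed
  ultimately show ?thesis
    by metis
next
  case False
  let ?l = "linear_poly c"
  obtain p where p: "poly_eval ?l p \<noteq> 0"
    using ex_poly_eval_nonzero linear_poly_eq_0_iff assms(5) by blast
  define a where "a = poly_eval g p / poly_eval ?l p ^ k"
  define f where "f = g - Const a * ?l ^ k"
  have "homogeneous (0 + k * 1) (Const a * ?l ^ k)"
    by (intro homogeneous_mult homogeneous_power homogeneous_Const homogeneous_linear_poly)
  then have "homogeneous k f"
    unfolding f_def using homogeneous_diff[OF assms(3)] by simp
  moreover have "poly_eval f (p + u) = 0" if u: "poly_eval ?l u = 0" for u
  proof -
    have "dir_deriv u g = 0"
      using False u by blast
    then have "poly_eval g (p + u) = poly_eval g p"
      using poly_eval_translate[of u g p 1] by simp
    then show ?thesis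
      using u p by (simp add: f_def a_def poly_eval_simps poly_eval_linear_poly_add)
  qed
  ultimately have "f = 0"
    by (rule homogeneous_eq_0_if_vanishes_on_hyperplane[OF _ p])
  then have g: "g = Const a * ?l ^ k"
    by (simp add: f_def)
  then have "a \<noteq> 0"
    using assms(2) by (auto simp: Const.\<iota>_0)
  then have "?l ^ k = Const (1 / a) * g + 0 * h"
    by (simp add: g Const_1 flip: mult.assoc Const_mult)
  then show ?thesis
    unfolding span_pair_iff by blast
qed

section \<open>Finite generation of ideals\<close>

text \<open>A monotone subsequence that is not increasing is nonincreasing, hence constant from an
  index where its minimum is attained.\<close>

lemma ex_mono_subseq_nat:
  fixes s :: "nat \<Rightarrow> nat"
  shows "\<exists>r :: nat \<Rightarrow> nat. strict_mono r \<and> mono (s \<circ> r)"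
proof -
  obtain r where r: "strict_mono r" "monoseq (\<lambda>n. s (r n))"
    using seq_monosub[of s] by blast
  show ?thesis
  proof (cases "mono (s \<circ> r)")
    case False
    then have anti: "s (r n) \<le> s (r m)" if "m \<le> n" for m n
      using r(2) that by (auto simp: monoseq_def mono_def comp_def)
    obtain N where N: "\<And>n. s (r N) \<le> s (r n)"
      using ex_has_least_nat[of "\<lambda>_. True" 0 "\<lambda>n. s (r n)"] by auto
    have "s (r (N + n)) = s (r N)" for n
      using N[of "N + n"] anti[of N "N + n"] by simp
    then have "mono (s \<circ> (\<lambda>n. r (N + n)))"
      by (simp add: mono_def)
    moreover have "strict_mono (\<lambda>n. r (N + n))"
      using r(1) by (simp add: strict_mono_def)
    ultimately show ?thesis
      by blast
  qed (use r in blast)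
qed

text \<open>Dickson's lemma: the sequence is thinned out once per coordinate, until all exponents
  are nondecreasing along it; its first two terms then do.\<close>

lemma dickson:
  fixes s :: "nat \<Rightarrow> coord \<Rightarrow>\<^sub>0 nat"
  shows "\<exists>i j. i < j \<and> (\<forall>x. Poly_Mapping.lookup (s i) x \<le> Poly_Mapping.lookup (s j) x)"
proof -
  have "finite A \<Longrightarrow> \<exists>r :: nat \<Rightarrow> nat. strict_mono r \<and> (\<forall>x\<in>A. mono (\<lambda>n. Poly_Mapping.lookup (s (r n)) x))"
    for A :: "coord set"
  proof (induction A rule: finite_induct)
    case empty
    show ?case
      by (intro exI[of _ id]) (simp add: strict_mono_def)
  next
    case (insert x A)
    then obtain r :: "nat \<Rightarrow> nat" where r: "strict_mono r" "\<forall>x\<in>A. mono (\<lambda>n. Poly_Mapping.lookup (s (r n)) x)"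
      by blast
    obtain q :: "nat \<Rightarrow> nat" where q: "strict_mono q" "mono ((\<lambda>n. Poly_Mapping.lookup (s (r n)) x) \<circ> q)"
      using ex_mono_subseq_nat by blast
    have "strict_mono (r \<circ> q)"
      using r(1) q(1) by (simp add: strict_mono_def)
    moreover have "mono (\<lambda>n. Poly_Mapping.lookup (s ((r \<circ> q) n)) y)" if "y \<in> insert x A" for y
      using that r(2) q by (auto simp: mono_def comp_def strict_mono_less_eq)
    ultimately show ?case
      by blast
  qed
  from this[of UNIV] obtain r :: "nat \<Rightarrow> nat" where r: "strict_mono r" "\<And>x. mono (\<lambda>n. Poly_Mapping.lookup (s (r n)) x)"
    by auto
  show ?thesis
    using r(2) strict_monoD[OF r(1), of 0 1]
    by (intro exI[of _ "r 0"] exI[of _ "r 1"]) (auto simp: mono_def)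
qed

text \<open>The order on monomials is lexicographic, so the first coordinate that occurs in
  \<open>m\<close> decides.\<close>

lemma monomial_nonneg: "(0 :: coord \<Rightarrow>\<^sub>0 nat) \<le> m"
proof (cases "m = 0")
  case False
  then have ne: "Poly_Mapping.keys m \<noteq> {}"
    by simp
  define k where "k = Min (Poly_Mapping.keys m)"
  have "k \<in> Poly_Mapping.keys m"
    unfolding k_def using ne by (intro Min_in) auto
  moreover have "Poly_Mapping.lookup m k' = 0" if "k' < k" for k'
    using that unfolding k_def by (metis Min_le finite_keys in_keys_iff not_less)
  ultimately have "less_fun (Poly_Mapping.lookup 0) (Poly_Mapping.lookup m)"
    unfolding less_fun_def by (intro exI[of _ k]) (auto simp: in_keys_iff)
  then show ?thesis
    by (simp add: less_eq_poly_mapping.rep_eq)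
qed simp

lemma monomial_split:
  fixes m n :: "coord \<Rightarrow>\<^sub>0 nat"
  assumes "\<forall>x. Poly_Mapping.lookup m x \<le> Poly_Mapping.lookup n x"
  shows "n = m + (n - m)"
  using assms by (intro poly_mapping_eqI) (simp add: lookup_add lookup_minus)

text \<open>By Dickson's lemma a descending sequence contains a monomial that divides a later one;
  but the order respects products and has the monomial 1 as least element.\<close>

lemma wf_monomials: "wf {(m, n :: coord \<Rightarrow>\<^sub>0 nat). m < n}"
  unfolding wf_iff_no_infinite_down_chain
proof
  assume "\<exists>s. \<forall>i. (s (Suc i), s i) \<in> {(m, n :: coord \<Rightarrow>\<^sub>0 nat). m < n}"
  then obtain s :: "nat \<Rightarrow> coord \<Rightarrow>\<^sub>0 nat" where step: "\<And>i. s (Suc i) < s i"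
    by auto
  have less: "s j < s i" if "i < j" for i j
    using that by (induction rule: less_Suc_induct) (auto intro: step less_trans)
  obtain i j where ij: "i < j" "\<forall>x. Poly_Mapping.lookup (s i) x \<le> Poly_Mapping.lookup (s j) x"
    using dickson by blast
  have "s i + 0 \<le> s i + (s j - s i)"
    by (intro add_left_mono monomial_nonneg)
  then show False
    using monomial_split[OF ij(2)] less[OF ij(1)] by simp
qed

text \<open>At 0 this is the unspecified \<open>Max {}\<close>, hence the assumptions below that
  polynomials are nonzero.\<close>

definition lead_mon :: "poly4 \<Rightarrow> coord \<Rightarrow>\<^sub>0 nat" where
  "lead_mon f = Max (Poly_Mapping.keys f)"

lemma lead_mon_in_keys: "f \<noteq> 0 \<Longrightarrow> lead_mon f \<in> Poly_Mapping.keys f"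
  unfolding lead_mon_def by (intro Max_in) auto

lemma le_lead_mon: "m \<in> Poly_Mapping.keys f \<Longrightarrow> m \<le> lead_mon f"
  unfolding lead_mon_def by (intro Max_ge) auto

lemma lookup_single_mult:
  "Poly_Mapping.lookup (Poly_Mapping.single d a * f :: poly4) (d + m) = a * Poly_Mapping.lookup f m"
proof -
  have "Poly_Mapping.single d a * f = (\<Sum>n\<in>Poly_Mapping.keys f.
      Poly_Mapping.single (d + n) (a * Poly_Mapping.lookup f n))"
    by (subst (1) sum_singles[of f, symmetric]) (simp only: sum_distrib_left mult_single)
  then have "Poly_Mapping.lookup (Poly_Mapping.single d a * f) (d + m) =
      (\<Sum>n\<in>Poly_Mapping.keys f. if n = m then a * Poly_Mapping.lookup f n else 0)"
    by (simp add: lookup_sum lookup_single when_def)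
  then show ?thesis
    by (simp add: sum.delta in_keys_iff)
qed

lemma lead_mon_reduce:
  assumes "f \<noteq> 0" "p \<noteq> 0" "lead_mon p = lead_mon f + d"
  defines "c \<equiv> Poly_Mapping.lookup p (lead_mon p) / Poly_Mapping.lookup f (lead_mon f)"
  defines "r \<equiv> p - Poly_Mapping.single d c * f"
  assumes "r \<noteq> 0"
  shows "lead_mon r < lead_mon p"
proof -
  let ?t = "Poly_Mapping.single d c * f"
  have "lead_mon r \<in> Poly_Mapping.keys p \<union> Poly_Mapping.keys ?t"
    using lead_mon_in_keys[OF assms(6)] keys_diff[of p ?t] unfolding r_def by blast
  moreover have "m \<le> lead_mon p" if "m \<in> Poly_Mapping.keys ?t" for m
  proof -
    from subsetD[OF keys_mult that] obtain e n where "e \<in> Poly_Mapping.keys (Poly_Mapping.single d c)" "n \<in> Poly_Mapping.keys f" "m = e + n"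
      by blast
    then have "n \<in> Poly_Mapping.keys f" "m = d + n"
      by (auto split: if_splits)
    then show ?thesis
      using le_lead_mon[of n f] assms(3) by (simp add: add.commute add_left_mono)
  qed
  ultimately have "lead_mon r \<le> lead_mon p"
    using le_lead_mon by blast
  moreover have "lead_mon r \<noteq> lead_mon p"
  proof
    assume eq: "lead_mon r = lead_mon p"
    have "Poly_Mapping.lookup f (lead_mon f) \<noteq> 0"
      using lead_mon_in_keys[OF assms(1)] by (simp add: in_keys_iff)
    then have "Poly_Mapping.lookup r (lead_mon p) = 0"
      using lookup_single_mult[of d c f "lead_mon f"]
      by (simp add: r_def lookup_minus assms(3) add.commute[of d] c_def)
    then show False
      using lead_mon_in_keys[OF assms(6)] eq by (simp add: in_keys_iff)
  qed
  ultimately show ?thesis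
    by simp
qed

text \<open>Hilbert's basis theorem. Otherwise one could keep picking an element outside the span of
  the earlier ones, with minimal leading monomial. By Dickson's lemma the leading monomial of some
  \<open>f i\<close> divides that of a later \<open>f j\<close>; reducing \<open>f j\<close> by
  \<open>f i\<close> gives an element still outside the span with a smaller leading
  monomial.\<close>

lemma ideal_finitely_generated:
  assumes I: "ideal.subspace I"
  shows "\<exists>F. finite F \<and> F \<subseteq> I \<and> I = ideal.span F"
proof (rule ccontr)
  assume "\<not> ?thesis"
  then have ex: "\<exists>f. f \<in> I - ideal.span F" if "finite F" "F \<subseteq> I" for F
    using that ideal.span_minimal[OF that(2) I] by blast
  have "\<exists>f\<in>I - ideal.span F. \<forall>r\<in>I - ideal.span F. \<not> lead_mon r < lead_mon f"
    if "finite F" "F \<subseteq> I" for F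
  proof -
    have "wf {(f, g). lead_mon f < lead_mon g}"
      using wf_inv_image[OF wf_monomials, of lead_mon] by (simp add: inv_image_def)
    then show ?thesis
      using ex[OF that] unfolding wf_eq_minimal by (metis (no_types, lifting) case_prodI mem_Collect_eq)
  qed
  then obtain pick where pick: "\<And>F. finite F \<Longrightarrow> F \<subseteq> I \<Longrightarrow> pick F \<in> I - ideal.span F"
      "\<And>F r. finite F \<Longrightarrow> F \<subseteq> I \<Longrightarrow> r \<in> I - ideal.span F \<Longrightarrow> \<not> lead_mon r < lead_mon (pick F)"
    by metis
  define S where "S = rec_nat {} (\<lambda>_ F. insert (pick F) F)"
  have S_Suc: "S (Suc n) = insert (pick (S n)) (S n)" for n
    by (simp add: S_def)
  have S: "finite (S n) \<and> S n \<subseteq> I" for n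
    by (induction n) (use pick(1) in \<open>auto simp: S_def\<close>)
  have mono: "S m \<subseteq> S n" if "m \<le> n" for m n
    using that by (rule lift_Suc_mono_le[of S, rotated]) (auto simp: S_Suc)
  define f where "f n = pick (S n)" for n
  obtain i j where ij: "i < j"
    "\<forall>x. Poly_Mapping.lookup (lead_mon (f i)) x \<le> Poly_Mapping.lookup (lead_mon (f j)) x"
    using dickson[of "\<lambda>n. lead_mon (f n)"] by blast
  define d where "d = lead_mon (f j) - lead_mon (f i)"
  define c where "c = Poly_Mapping.lookup (f j) (lead_mon (f j)) / Poly_Mapping.lookup (f i) (lead_mon (f i))"
  define r where "r = f j - Poly_Mapping.single d c * f i"
  have f: "f n \<in> I" "f n \<notin> ideal.span (S n)" for n
    using pick(1) S unfolding f_def by blast+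
  then have nz: "f n \<noteq> 0" for n
    using ideal.span_zero by metis
  have "f i \<in> S j"
    using mono[of "Suc i" j] ij(1) by (auto simp: f_def S_Suc)
  then have t: "Poly_Mapping.single d c * f i \<in> ideal.span (S j)"
    by (intro ideal.span_scale ideal.span_base)
  have "r \<notin> ideal.span (S j)"
    using ideal.span_add[OF _ t] f(2)[of j] unfolding r_def by (metis diff_add_cancel)
  moreover have "r \<in> I"
    unfolding r_def using I f(1) ideal.subspace_diff ideal.subspace_scale by blast
  moreover from calculation have "r \<noteq> 0"
    using ideal.span_zero by metis
  moreover have "lead_mon (f j) = lead_mon (f i) + d"
    unfolding d_def by (rule monomial_split[OF ij(2)])
  ultimately have "r \<in> I - ideal.span (S j)" "lead_mon r < lead_mon (f j)"
    using lead_mon_reduce[OF nz nz] unfolding r_def c_def by blast+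
  then show False
    using pick(2) S unfolding f_def by blast
qed

section \<open>Irreducible decomposition\<close>

definition vanishing_ideal :: "proj3 set \<Rightarrow> poly4 set" where
  "vanishing_ideal Z = {f. \<forall>p\<in>Z. vanishes_at f p}"

lemma subspace_vanishing_ideal: "ideal.subspace (vanishing_ideal Z)"
  by (rule ideal.subspaceI) (auto simp: vanishing_ideal_def vanishes_at_def poly_eval_simps)

lemma zero_locus_vanishing_ideal:
  assumes "zariski_closed Z"
  shows "zero_locus (vanishing_ideal Z) = Z"
  using assms by (auto simp: zariski_closed_def vanishing_ideal_def zero_locus_def)

lemma zero_locus_span: "zero_locus (ideal.span F) = zero_locus F"
proof
  show "zero_locus (ideal.span F) \<subseteq> zero_locus F"
    using ideal.span_superset by (auto simp: zero_locus_def)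
  have "ideal.span F \<subseteq> vanishing_ideal (zero_locus F)"
    by (intro ideal.span_minimal subspace_vanishing_ideal) (auto simp: vanishing_ideal_def zero_locus_def)
  then show "zero_locus F \<subseteq> zero_locus (ideal.span F)"
    by (auto simp: vanishing_ideal_def zero_locus_def)
qed

text \<open>The vanishing ideals of a descending chain ascend; their union is a finitely generated
  ideal, and its generators already lie in one member. Closed sets are recovered from their
  vanishing ideals, so the chain stops.\<close>

lemma wf_zariski_closed: "wf {(A, B). zariski_closed A \<and> zariski_closed B \<and> A \<subset> B}"
  unfolding wf_iff_no_infinite_down_chain
proof
  assume "\<exists>s. \<forall>i. (s (Suc i), s i) \<in> {(A, B). zariski_closed A \<and> zariski_closed B \<and> A \<subset> B}"
  then obtain Z where "\<forall>i. (Z (Suc i), Z i) \<in> {(A, B). zariski_closed A \<and> zariski_closed B \<and> A \<subset> B}"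
    by blast
  then have Z: "\<And>i. zariski_closed (Z i)" "\<And>i. Z (Suc i) \<subset> Z i"
    by auto
  define I where "I = (\<Union>i. vanishing_ideal (Z i))"
  have mono: "vanishing_ideal (Z i) \<subseteq> vanishing_ideal (Z j)" if "i \<le> j" for i j
    using that
  proof (rule lift_Suc_mono_le[rotated])
    show "vanishing_ideal (Z n) \<subseteq> vanishing_ideal (Z (Suc n))" for n
      using Z(2)[of n] by (auto simp: vanishing_ideal_def)
  qed
  have "ideal.subspace I"
  proof (rule ideal.subspaceI)
    show "0 \<in> I"
      using ideal.subspace_0[OF subspace_vanishing_ideal] by (auto simp: I_def)
    show "x + y \<in> I" if xy: "x \<in> I" "y \<in> I" for x y
    proof -
      obtain i j where "x \<in> vanishing_ideal (Z i)" "y \<in> vanishing_ideal (Z j)"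
        using xy unfolding I_def by blast
      then have "x \<in> vanishing_ideal (Z (max i j))" "y \<in> vanishing_ideal (Z (max i j))"
        using mono[of i "max i j"] mono[of j "max i j"] by auto
      then show ?thesis
        using ideal.subspace_add[OF subspace_vanishing_ideal] by (auto simp: I_def)
    qed
    show "c * x \<in> I" if "x \<in> I" for c x
      using that ideal.subspace_scale[OF subspace_vanishing_ideal] by (auto simp: I_def)
  qed
  then obtain F where F: "finite F" "F \<subseteq> I" "I = ideal.span F"
    using ideal_finitely_generated by blast
  have "\<exists>i. G \<subseteq> vanishing_ideal (Z i)" if "finite G" "G \<subseteq> I" for G
    using that
  proof (induction G rule: finite_induct)
    case (insert x G)
    then obtain i j where "G \<subseteq> vanishing_ideal (Z i)" "x \<in> vanishing_ideal (Z j)"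
      unfolding I_def by blast
    then have "insert x G \<subseteq> vanishing_ideal (Z (max i j))"
      using mono[of i "max i j"] mono[of j "max i j"] by auto
    then show ?case
      by blast
  qed simp
  then obtain i where "F \<subseteq> vanishing_ideal (Z i)"
    using F by blast
  then have "I \<subseteq> vanishing_ideal (Z i)"
    unfolding F(3) by (intro ideal.span_minimal subspace_vanishing_ideal)
  then have "vanishing_ideal (Z (Suc i)) \<subseteq> vanishing_ideal (Z i)"
    by (auto simp: I_def)
  then have "zero_locus (vanishing_ideal (Z i)) \<subseteq> zero_locus (vanishing_ideal (Z (Suc i)))"
    by (auto simp: zero_locus_def)
  then show False
    using Z(2)[of i] zero_locus_vanishing_ideal[OF Z(1)] by blast
qed

lemma irreducible_decomposition:
  assumes "zariski_closed Z"
  shows "\<exists>\<C>. finite \<C> \<and> (\<forall>C\<in>\<C>. irreducible_closed C) \<and> Z = \<Union>\<C>"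
  using assms
proof (induction Z rule: wf_induct_rule[OF wf_zariski_closed])
  case (1 Z)
  show ?case
  proof (cases "Z = {} \<or> irreducible_closed Z")
    case True
    then show ?thesis
      by (intro exI[of _ "if Z = {} then {} else {Z}"]) auto
  next
    case False
    then obtain A B where AB: "zariski_closed A" "zariski_closed B" "Z = A \<union> B" "Z \<noteq> A" "Z \<noteq> B"
      using 1 by (auto simp: irreducible_closed_def)
    have "\<exists>\<C>. finite \<C> \<and> (\<forall>C\<in>\<C>. irreducible_closed C) \<and> A = \<Union>\<C>"
      "\<exists>\<C>. finite \<C> \<and> (\<forall>C\<in>\<C>. irreducible_closed C) \<and> B = \<Union>\<C>"
      using 1 AB by blast+
    then obtain \<A> \<B> where "finite \<A>" "\<forall>C\<in>\<A>. irreducible_closed C" "A = \<Union>\<A>"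
      "finite \<B>" "\<forall>C\<in>\<B>. irreducible_closed C" "B = \<Union>\<B>"
      by blast
    then show ?thesis
      using AB(3) by (intro exI[of _ "\<A> \<union> \<B>"]) auto
  qed
qed

lemma zariski_closed_Int:
  assumes "zariski_closed A" "zariski_closed B"
  shows "zariski_closed (A \<inter> B)"
proof -
  obtain F G where "\<forall>f\<in>F. \<exists>k. homogeneous k f" "A = zero_locus F"
    "\<forall>f\<in>G. \<exists>k. homogeneous k f" "B = zero_locus G"
    using assms unfolding zariski_closed_def by blast
  then show ?thesis
    unfolding zariski_closed_def by (intro exI[of _ "F \<union> G"]) (auto simp: zero_locus_def)
qed

section \<open>Points of projective space and chains of closed sets\<close>

definition point :: "complex ^ coord \<Rightarrow> proj3" where
  "point v = Abs_proj3 (range (\<lambda>c. c *s v))"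

lemma Rep_point: "v \<noteq> 0 \<Longrightarrow> Rep_proj3 (point v) = range (\<lambda>c. c *s v)"
  unfolding point_def by (rule Abs_proj3_inverse) blast

lemma in_Rep_point: "v \<noteq> 0 \<Longrightarrow> v \<in> Rep_proj3 (point v)"
  by (metis Rep_point rangeI vector_smult_lid)

lemma point_cases: obtains v where "v \<noteq> 0" "p = point v"
proof -
  obtain v where "v \<noteq> 0" "Rep_proj3 p = range (\<lambda>c. c *s v)"
    using Rep_proj3[of p] by blast
  then show ?thesis
    using that by (metis Rep_point Rep_proj3_inject)
qed

lemma point_eqD:
  assumes "point v = point w" "v \<noteq> 0" "w \<noteq> 0"
  obtains a where "v = a *s w" "a \<noteq> 0"
  using in_Rep_point[OF assms(2)] assms by (auto simp: Rep_point)

lemma point_scale: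
  assumes "v \<noteq> 0" "a \<noteq> 0"
  shows "point (a *s v) = point v"
proof -
  have "a *s v \<in> Rep_proj3 (point v)" "a *s v \<noteq> 0"
    using assms by (auto simp: Rep_point)
  then show ?thesis
    using Rep_proj3_eq Rep_point by (metis Rep_proj3_inject)
qed

lemma vanishes_at_point: "homogeneous k f \<Longrightarrow> v \<noteq> 0 \<Longrightarrow> vanishes_at f (point v) \<longleftrightarrow> poly_eval f v = 0"
  using vanishes_iff in_Rep_point by blast

lemma irreducible_closed_point: "irreducible_closed {p}"
proof -
  obtain v where v: "v \<noteq> 0" "p = point v"
    by (rule point_cases)
  \<comment> \<open>The 2 x 2 minors of the matrix with rows \<open>v\<close> and the variables;
    they vanish at \<open>w\<close> exactly when \<open>w\<close> is a multiple of
    \<open>v\<close>.\<close>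
  define F where "F = {Const (v $ i) * Var j - Const (v $ j) * Var i | i j. True}"
  have hom: "homogeneous 1 f" if "f \<in> F" for f
    using that homogeneous_mult[OF homogeneous_Const homogeneous_Var]
    by (auto simp: F_def intro!: homogeneous_diff)
  have "zero_locus F = {p}"
  proof (rule set_eqI)
    fix q
    obtain w where w: "w \<noteq> 0" "q = point w"
      by (rule point_cases)
    have "q \<in> zero_locus F \<longleftrightarrow> (\<forall>f\<in>F. poly_eval f w = 0)"
      using vanishes_at_point[OF hom w(1)] by (simp add: zero_locus_def w(2))
    also have "\<dots> \<longleftrightarrow> (\<forall>i j. poly_eval (Const (v $ i) * Var j - Const (v $ j) * Var i) w = 0)"
      unfolding F_def by blast
    also have "\<dots> \<longleftrightarrow> (\<forall>i j. v $ i * w $ j = v $ j * w $ i)"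
      by (simp add: poly_eval_simps)
    also have "\<dots> \<longleftrightarrow> q = p"
    proof
      assume *: "\<forall>i j. v $ i * w $ j = v $ j * w $ i"
      obtain i where i: "v $ i \<noteq> 0"
        using v(1) by (auto simp: vec_eq_iff)
      have "w = (w $ i / v $ i) *s v"
        using * i by (auto simp: vec_eq_iff field_simps)
      moreover from this have "w $ i / v $ i \<noteq> 0"
        using w(1) by auto
      ultimately show "q = p"
        using point_scale[OF v(1)] v(2) w(2) by metis
    next
      assume "q = p"
      then obtain a where "w = a *s v"
        using point_eqD v w by metis
      then show "\<forall>i j. v $ i * w $ j = v $ j * w $ i"
        by simp
    qed
    finally show "q \<in> zero_locus F \<longleftrightarrow> q \<in> {p}"
      by simp
  qed
  then have "zariski_closed {p}"
    using hom unfolding zariski_closed_def by metis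
  then show ?thesis
    by (auto simp: irreducible_closed_def singleton_Un_iff)
qed

text \<open>A component of \<open>D\<close> with more than one point would form a chain together
  with one of its points and \<open>C\<close>. So \<open>D\<close> is a finite union of
  points.\<close>

lemma finite_if_no_chain:
  assumes "zariski_closed D" "D \<subset> C"
    and nochain: "\<And>E p. irreducible_closed E \<Longrightarrow> {p} \<subset> E \<Longrightarrow> \<not> E \<subset> C"
  shows "finite D"
proof -
  obtain \<E> where \<E>: "finite \<E>" "\<forall>E\<in>\<E>. irreducible_closed E" "D = \<Union>\<E>"
    using irreducible_decomposition[OF assms(1)] by blast
  have "finite E" if "E \<in> \<E>" for E
  proof -
    have E: "irreducible_closed E" "E \<subset> C"
      using that \<E> assms(2) by auto
    then obtain p where "p \<in> E"
      by (auto simp: irreducible_closed_def)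
    then have "E = {p}"
      using nochain[OF E(1)] E(2) by blast
    then show ?thesis
      by simp
  qed
  then show ?thesis
    using \<E> by auto
qed

text \<open>Without a chain of length 2 proper closed subsets of the components of \<open>Z\<close> are finite. By the
  pigeonhole principle one component then lies in two members of the family.\<close>

lemma exists_chain:
  assumes Z: "zariski_closed Z" and \<Lambda>: "infinite \<Lambda>"
    and H: "\<And>l. l \<in> \<Lambda> \<Longrightarrow> zariski_closed (H l)" "\<And>l. l \<in> \<Lambda> \<Longrightarrow> infinite (Z \<inter> H l)"
    and fin: "\<And>l m. l \<in> \<Lambda> \<Longrightarrow> m \<in> \<Lambda> \<Longrightarrow> l \<noteq> m \<Longrightarrow> finite (Z \<inter> H l \<inter> H m)"
  shows "\<exists>p E C. irreducible_closed E \<and> irreducible_closed C \<and> {p} \<subset> E \<and> E \<subset> C \<and> C \<subseteq> Z"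
proof (rule ccontr)
  assume no: "\<not> ?thesis"
  obtain \<C> where \<C>: "finite \<C>" "\<forall>C\<in>\<C>. irreducible_closed C" "Z = \<Union>\<C>"
    using irreducible_decomposition[OF Z] by blast
  have "\<exists>C\<in>\<C>. infinite (C \<inter> H l)" if "l \<in> \<Lambda>" for l
  proof (rule ccontr)
    assume "\<not> ?thesis"
    then have "finite (\<Union>C\<in>\<C>. C \<inter> H l)"
      using \<C>(1) by blast
    moreover have "Z \<inter> H l = (\<Union>C\<in>\<C>. C \<inter> H l)"
      using \<C>(3) by blast
    ultimately show False
      using H(2)[OF that] by simp
  qed
  then obtain comp where comp: "\<And>l. l \<in> \<Lambda> \<Longrightarrow> comp l \<in> \<C>" "\<And>l. l \<in> \<Lambda> \<Longrightarrow> infinite (comp l \<inter> H l)"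
    by metis
  have "finite (comp ` \<Lambda>)"
    using comp(1) by (meson \<C>(1) finite_subset image_subsetI)
  then have "\<not> inj_on comp \<Lambda>"
    using \<Lambda> finite_imageD by blast
  then obtain l m where lm: "l \<in> \<Lambda>" "m \<in> \<Lambda>" "l \<noteq> m" "comp l = comp m"
    by (auto simp: inj_on_def)
  have sub: "comp l \<subseteq> H l" if "l \<in> \<Lambda>" for l
  proof (rule ccontr)
    assume "\<not> comp l \<subseteq> H l"
    then have proper: "comp l \<inter> H l \<subset> comp l"
      by blast
    have irr: "irreducible_closed (comp l)" "comp l \<subseteq> Z"
      using comp(1)[OF that] \<C> by auto
    then have "zariski_closed (comp l \<inter> H l)"
      using H(1)[OF that] zariski_closed_Int by (auto simp: irreducible_closed_def)
    then have "finite (comp l \<inter> H l)"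
      using proper by (rule finite_if_no_chain) (use no irr in blast)
    then show False
      using comp(2)[OF that] by blast
  qed
  have "comp l \<inter> H l \<subseteq> Z \<inter> H l \<inter> H m"
    using sub[OF lm(1)] sub[OF lm(2)] lm(4) comp(1)[OF lm(1)] \<C>(3) by blast
  then show False
    using fin[OF lm(1-3)] comp(2)[OF lm(1)] finite_subset by blast
qed

lemma zariski_dim_ge_2:
  assumes "irreducible_closed E" "irreducible_closed C" "{p} \<subset> E" "E \<subset> C" "C \<subseteq> Z"
  shows "zariski_dim Z \<ge> 2"
proof -
  define D where "D i = (if i = 0 then {p} else if i = 1 then E else C)" for i :: nat
  have "\<forall>i\<le>2. irreducible_closed (D i) \<and> D i \<subseteq> Z" "\<forall>i<2. D i \<subset> D (Suc i)"
    using assms irreducible_closed_point by (auto simp: D_def less_2_cases_iff)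
  then have "ereal (real 2) \<le> zariski_dim Z"
    unfolding zariski_dim_def by (intro Sup_upper CollectI exI[of _ 2] conjI exI[of _ D] refl)
  then show ?thesis
    by simp
qed

section \<open>Common zeros of a pair of surfaces\<close>

text \<open>Linear factors of \<open>G\<close> are stripped one at a time: a root of
  \<open>G\<close> is not a root of \<open>H\<close>, hence is one of \<open>R\<close>. A constant
  \<open>G\<close> is a unit.\<close>

lemma complex_poly_dvd_cancel:
  fixes G H R :: "complex poly"
  assumes "G dvd H * R" "G \<noteq> 0" "\<And>x. poly G x = 0 \<Longrightarrow> poly H x \<noteq> 0"
  shows "G dvd R"
  using assms
proof (induction "degree G" arbitrary: G R)
  case 0
  then have "is_unit G"
    by (simp add: is_unit_iff_degree)
  then show ?case
    by (rule unit_imp_dvd)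
next
  case (Suc n)
  have "\<not> constant (poly G)"
    using Suc.hyps(2) by (simp add: constant_degree)
  then obtain x where x: "poly G x = 0"
    using fundamental_theorem_of_algebra by blast
  then obtain G' where G': "G = [:- x, 1:] * G'"
    using poly_eq_0_iff_dvd by (metis dvdE)
  obtain K where K: "H * R = G * K"
    using Suc.prems(1) by (rule dvdE)
  have "poly H x * poly R x = 0"
    using arg_cong[OF K, of "\<lambda>p. poly p x"] x by simp
  then have "poly R x = 0"
    using Suc.prems(3)[OF x] by simp
  then obtain R' where R': "R = [:- x, 1:] * R'"
    using poly_eq_0_iff_dvd by (metis dvdE)
  have "[:- x, 1:] * (H * R') = [:- x, 1:] * (G' * K)"
    using K unfolding G' R' by (simp only: ac_simps)
  then have "H * R' = G' * K"
    by (subst (asm) mult_cancel_left) simp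
  then have dvd: "G' dvd H * R'"
    by simp
  have "G' \<noteq> 0"
    using Suc.prems(2) G' by auto
  moreover from this have "n = degree G'"
    using Suc.hyps(2) unfolding G' by (simp add: degree_mult_eq del: mult_pCons_left)
  moreover have "poly H y \<noteq> 0" if "poly G' y = 0" for y
    using Suc.prems(3)[of y] that unfolding G' by (simp del: mult_pCons_left)
  ultimately have "G' dvd R'"
    using Suc.hyps(1)[OF _ dvd] by blast
  then show ?case
    unfolding G' R' by (rule mult_dvd_mono[OF dvd_refl])
qed

text \<open>By homogeneity f(v + t d) = t^k f(d + (1/t) v). So the polynomial on the line is the
  reversal of the one with \<open>v\<close> and \<open>d\<close> exchanged, and its k-th coefficient
  is the constant term f(d) of the latter.\<close>

lemma coeff_on_line:
  assumes "homogeneous k f"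
  shows "coeff (on_line v d f) k = poly_eval f d"
proof -
  let ?P = "on_line d v f"
  define R where "R = (\<Sum>j\<le>k. monom (coeff ?P j) (k - j))"
  have "poly (on_line v d f - R) t = 0" if "t \<noteq> 0" for t
  proof -
    have "poly (on_line v d f) t = poly_eval f (t *s (d + (1 / t) *s v))"
      using that by (simp add: poly_on_line vector_add_ldistrib vector_smult_assoc add.commute)
    also have "\<dots> = t ^ k * poly ?P (1 / t)"
      by (simp only: poly_eval_scale[OF assms] poly_on_line)
    also have "poly ?P (1 / t) = (\<Sum>j\<le>k. coeff ?P j * (1 / t) ^ j)"
      using arg_cong[OF poly_as_sum_of_monoms'[OF degree_on_line[OF assms]], of "\<lambda>p. poly p (1 / t)"]
      by (simp add: poly_sum poly_monom)
    also have "t ^ k * \<dots> = poly R t"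
      using that by (simp add: R_def poly_sum poly_monom sum_distrib_left power_diff field_simps)
    finally show ?thesis
      by simp
  qed
  then have "UNIV - {0} \<subseteq> {t. poly (on_line v d f - R) t = 0}"
    by blast
  moreover have "infinite (UNIV - {0 :: complex})"
    by (simp add: infinite_UNIV_char_0)
  ultimately have "on_line v d f - R = 0"
    using poly_roots_finite finite_subset by blast
  then have "coeff (on_line v d f) k = coeff R k"
    by simp
  also have "\<dots> = (\<Sum>j\<le>k. if j = 0 then coeff ?P j else 0)"
    unfolding R_def coeff_sum by (intro sum.cong) auto
  also have "\<dots> = poly_eval f d"
    using poly_on_line[of d v f 0] by (simp add: poly_0_coeff_0)
  finally show ?thesis .
qed

text \<open>This is f(X + T d) as a polynomial in T over S: \<open>f\<close> on the generic line in
  direction \<open>d\<close>. Evaluating the coefficients at \<open>v\<close> gives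
  \<open>on_line v d f\<close>.\<close>

definition shift :: "complex ^ coord \<Rightarrow> poly4 \<Rightarrow> poly4 poly" where
  "shift d = subst (\<lambda>c. [:Const c:]) (\<lambda>i. [:Var i, Const (d $ i):])"

interpretation shift: scalars "\<lambda>c. [:Const c:]"
  by standard (simp_all add: Const_add Const_mult Const_1 one_pCons)

lemmas shift_simps = shift.subst_simps[of "\<lambda>i. [:Var i, Const (d $ i):]" for d, folded shift_def]

lemma poly_shift_0: "poly (shift d f) 0 = f"
  by (induction f rule: poly4_induct) (simp_all add: shift_simps)

abbreviation eval_coeffs :: "complex ^ coord \<Rightarrow> poly4 poly \<Rightarrow> complex poly" where
  "eval_coeffs v \<equiv> map_poly (\<lambda>a. poly_eval a v)"

lemma eval_coeffs_add: "eval_coeffs v (P + Q) = eval_coeffs v P + eval_coeffs v Q"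
  by (rule poly_eqI) (simp add: coeff_map_poly poly_eval_simps)

lemma eval_coeffs_mult: "eval_coeffs v (P * Q) = eval_coeffs v P * eval_coeffs v Q"
  by (rule poly_eqI) (simp add: coeff_map_poly coeff_mult poly_eval_simps)

lemma eval_coeffs_shift: "eval_coeffs v (shift d f) = on_line v d f"
  unfolding on_line_def
  by (rule line.subst_unique)
    (simp_all add: shift_simps eval_coeffs_add eval_coeffs_mult map_poly_pCons poly_eval_simps)

lemma lead_coeff_shift:
  assumes "homogeneous k f" "poly_eval f d \<noteq> 0"
  shows "degree (shift d f) = k" "lead_coeff (shift d f) = Const (poly_eval f d)"
proof -
  have coeff: "poly_eval (coeff (shift d f) n) v = coeff (on_line v d f) n" for n v
    unfolding eval_coeffs_shift[symmetric] by (simp add: coeff_map_poly poly_eval_simps)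
  have k: "coeff (shift d f) k = Const (poly_eval f d)"
    unfolding poly_eq_iff_poly_eval coeff by (simp add: coeff_on_line[OF assms(1)] poly_eval_simps)
  have "coeff (shift d f) n = 0" if "n > k" for n
    unfolding poly_eq_iff_poly_eval coeff
    using le_less_trans[OF degree_on_line[OF assms(1)] that] by (simp add: coeff_eq_0 poly_eval_simps)
  then have "degree (shift d f) \<le> k"
    by (intro degree_le) blast
  moreover have "Const (poly_eval f d) \<noteq> 0"
    using assms(2) by (metis poly_eval_0 poly_eval_simps(6))
  then have "k \<le> degree (shift d f)"
    using k by (intro le_degree) simp
  ultimately show "degree (shift d f) = k"
    by simp
  then show "lead_coeff (shift d f) = Const (poly_eval f d)"
    using k by simp
qed

text \<open>Restricted to lines in direction \<open>d\<close>, \<open>g\<close> has a constant leading coefficient, so \<open>q\<close> can be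
  reduced modulo \<open>g\<close>. On a line where the remainder does not vanish, \<open>g\<close> divides the product of \<open>h\<close>
  and a nonzero polynomial of smaller degree, hence has a root in common with \<open>h\<close>.\<close>

lemma zero_divisor_common_zeros:
  assumes hom: "homogeneous k g" and d: "poly_eval g d \<noteq> 0"
    and dvd: "g dvd h * q" "\<not> g dvd q"
  shows "\<exists>s. s \<noteq> 0 \<and> (\<forall>v. poly_eval s v \<noteq> 0 \<longrightarrow>
    (\<exists>t. poly_eval g (v + t *s d) = 0 \<and> poly_eval h (v + t *s d) = 0))"
proof -
  let ?G = "shift d g" and ?H = "shift d h" and ?Q = "shift d q"
  note lc = lead_coeff_shift[OF hom d]
  have G: "?G \<noteq> 0"
    using poly_shift_0[of d g] d by (auto simp: poly_eval_0)
  \<comment> \<open>S is not a field, but the leading coefficient of the divisor is the nonzero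
    constant g(d), so the factor introduced by pseudo-division is a unit.\<close>
  define W R where "W = fst (pseudo_divmod ?Q ?G)" and "R = snd (pseudo_divmod ?Q ?G)"
  obtain m where m: "smult (lead_coeff ?G ^ m) ?Q = ?G * W + R"
    and R: "R = 0 \<or> degree R < degree ?G"
    using pseudo_divmod[OF G, of ?Q W R] by (auto simp: W_def R_def)
  define a where "a = poly_eval g d ^ m"
  have a: "a \<noteq> 0" "lead_coeff ?G ^ m = Const a"
    using d Const.subst_power by (simp_all add: a_def lc(2)) (induction m; simp add: Const_1 Const_mult)
  \<comment> \<open>Setting T = 0 in a division without remainder would make g divide q.\<close>
  have "R \<noteq> 0"
  proof
    assume "R = 0"
    then have "poly (smult (Const a) ?Q) 0 = poly (?G * W) 0"
      using m a(2) by simp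
    then have eq: "Const a * q = g * poly W 0"
      by (simp add: poly_shift_0)
    have "q = Const (1 / a * a) * q"
      using a(1) by (simp add: Const_1)
    also have "\<dots> = Const (1 / a) * (g * poly W 0)"
      by (simp only: Const_mult mult.assoc eq)
    also have "\<dots> = g * (Const (1 / a) * poly W 0)"
      by (simp only: ac_simps)
    finally show False
      using dvd(2) by (metis dvd_triv_left)
  qed
  obtain r where r: "h * q = g * r"
    using dvd(1) by (rule dvdE)
  have HR: "?G dvd ?H * R"
  proof -
    have "?H * R + ?G * (?H * W) = ?H * (?G * W + R)"
      by (simp only: distrib_left ac_simps)
    also have "\<dots> = smult (Const a) (?H * ?Q)"
      by (simp only: a(2) mult_smult_right flip: m)
    also have "?H * ?Q = ?G * shift d r"
      using r by (simp only: flip: shift_simps(9))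
    finally have "?H * R + ?G * (?H * W) = ?G * smult (Const a) (shift d r)"
      by simp
    then show ?thesis
      by (metis dvd_add_times_triv_right_iff dvd_triv_left mult.commute)
  qed
  show ?thesis
  \<comment> \<open>Where the leading coefficient of \<open>R\<close> does not vanish, the remainder
    stays nonzero on the line through \<open>v\<close>. Its degree is below that of g there, so g
    cannot divide it.\<close>
  proof (intro exI[of _ "lead_coeff R"] conjI allI impI)
    show "lead_coeff R \<noteq> 0"
      using \<open>R \<noteq> 0\<close> by simp
    fix v assume v: "poly_eval (lead_coeff R) v \<noteq> 0"
    let ?R = "eval_coeffs v R"
    have "coeff ?R (degree R) \<noteq> 0"
      using v by (simp add: coeff_map_poly poly_eval_simps)
    then have R0: "?R \<noteq> 0"
      by auto
    have "degree ?R \<le> degree R"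
      by (rule degree_le) (simp add: coeff_map_poly coeff_eq_0 poly_eval_simps)
    also have "\<dots> < k"
      using R \<open>R \<noteq> 0\<close> lc(1) by simp
    also have "k \<le> degree (on_line v d g)"
      using coeff_on_line[OF hom, of v d] d by (intro le_degree) simp
    finally have "\<not> on_line v d g dvd ?R"
      using R0 dvd_imp_degree_le by fastforce
    moreover have "on_line v d g dvd on_line v d h * ?R"
    proof -
      obtain K where "?H * R = ?G * K"
        using HR by (rule dvdE)
      then have "eval_coeffs v (?H * R) = eval_coeffs v (?G * K)"
        by simp
      then show ?thesis
        unfolding eval_coeffs_mult eval_coeffs_shift by simp
    qed
    moreover have "on_line v d g \<noteq> 0"
      using coeff_on_line[OF hom, of v d] d by auto
    ultimately obtain t where "poly (on_line v d g) t = 0" "poly (on_line v d h) t = 0"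
      using complex_poly_dvd_cancel by blast
    then show "\<exists>t. poly_eval g (v + t *s d) = 0 \<and> poly_eval h (v + t *s d) = 0"
      by (auto simp: poly_on_line)
  qed
qed

lemma other_coords:
  obtains j1 j2 j3 :: coord where "UNIV = {i, j1, j2, j3}" "distinct [i, j1, j2, j3]"
proof (cases i)
  case Cx
  then show ?thesis
    using that[of Cy Cz Ct] UNIV_coord by auto
next
  case Cy
  then show ?thesis
    using that[of Cx Cz Ct] UNIV_coord by auto
next
  case Cz
  then show ?thesis
    using that[of Cx Cy Ct] UNIV_coord by auto
next
  case Ct
  then show ?thesis
    using that[of Cx Cy Cz] UNIV_coord by auto
qed

text \<open>The family consists of the planes through a line \<open>L\<close> that contains a point \<open>d\<close> outside the
  surface \<open>g = 0\<close>: each of them meets \<open>g = h = 0\<close> in infinitely many points, and \<open>L\<close> itself in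
  finitely many.\<close>

lemma zariski_dim_zero_divisor:
  assumes k: "k \<ge> 1" and g: "g \<noteq> 0" "homogeneous k g" and h: "homogeneous k h"
    and dvd: "g dvd h * q" "\<not> g dvd q"
  shows "zariski_dim (zero_locus {g, h}) \<ge> 2"
proof -
  let ?Z = "zero_locus {g, h}"
  have Z: "point v \<in> ?Z \<longleftrightarrow> poly_eval g v = 0 \<and> poly_eval h v = 0" if "v \<noteq> 0" for v
    using vanishes_at_point[OF g(2) that] vanishes_at_point[OF h that] by (simp add: zero_locus_def)
  obtain d where d: "poly_eval g d \<noteq> 0"
    using ex_poly_eval_nonzero g(1) by blast
  obtain s where s: "s \<noteq> 0"
    and common: "\<And>v. poly_eval s v \<noteq> 0 \<Longrightarrow>
      \<exists>t. poly_eval g (v + t *s d) = 0 \<and> poly_eval h (v + t *s d) = 0"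
    using zero_divisor_common_zeros[OF g(2) d dvd] by blast
  have "d \<noteq> 0"
  proof
    assume "d = 0"
    then show False
      using poly_eval_scale[OF g(2), of 0 0] d k by (simp add: power_0_left)
  qed
  then obtain i where i: "d $ i \<noteq> 0"
    by (auto simp: vec_eq_iff)
  obtain j1 j2 j3 where j: "UNIV = {i, j1, j2, j3}" "distinct [i, j1, j2, j3]"
    by (rule other_coords)
  \<comment> \<open>Linear forms that vanish at \<open>d\<close>, the coordinates of the projection
    from \<open>d\<close>; moving a point along \<open>d\<close> does not change them.\<close>
  define \<mu> where "\<mu> j = Const (d $ i) * Var j - Const (d $ j) * Var i" for j
  define m where "m j v = poly_eval (\<mu> j) v" for j v
  have m: "m j v = d $ i * v $ j - d $ j * v $ i" for j v
    by (simp add: m_def \<mu>_def poly_eval_simps)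
  have m_scale: "m j (a *s v) = a * m j v" for j a v
    by (simp add: m right_diff_distrib ac_simps)
  have hom: "homogeneous 1 (\<mu> j)" for j
    unfolding \<mu>_def using homogeneous_mult[OF homogeneous_Const homogeneous_Var]
    by (intro homogeneous_diff) auto
  have "m j1 (axis j1 1) \<noteq> 0"
    using i j(2) by (simp add: m axis_def)
  then have "\<mu> j1 \<noteq> 0"
    unfolding m_def using poly_eval_0 by metis
  then obtain b where b: "poly_eval s b \<noteq> 0" "m j1 b \<noteq> 0"
    using ex_poly_eval_nonzero[of "s * \<mu> j1"] s by (auto simp: poly_eval_simps m_def)
  define x where "x l r = b + l *s axis j2 1 + r *s axis j3 1" for l r
  have nonzero: "infinite {t. poly_eval s (p + t *s u) \<noteq> 0}" if "poly_eval s p \<noteq> 0" for p u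
  proof -
    have "on_line p u s \<noteq> 0"
      using that poly_on_line[of p u s 0] by auto
    then have "finite {t. poly_eval s (p + t *s u) = 0}"
      using poly_roots_finite[of "on_line p u s"] by (simp add: poly_on_line)
    moreover have "{t. poly_eval s (p + t *s u) \<noteq> 0} = UNIV - {t. poly_eval s (p + t *s u) = 0}"
      by blast
    ultimately show ?thesis
      using infinite_UNIV_char_0 Diff_infinite_finite by metis
  qed
  define \<Lambda> where "\<Lambda> = {l. poly_eval s (b + l *s axis j2 1) \<noteq> 0}"
  define M where "M l = {r. poly_eval s (x l r) \<noteq> 0}" for l
  have inf: "infinite \<Lambda>" "l \<in> \<Lambda> \<Longrightarrow> infinite (M l)" for l
    using nonzero b(1) by (simp_all add: \<Lambda>_def M_def x_def)
  \<comment> \<open>The plane spanned by \<open>d\<close>, \<open>axis j3 1\<close> and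
    \<open>x l r\<close>, the same for every \<open>r\<close>: it prescribes the ratio of
    \<open>m j2\<close> to \<open>m j1\<close>.\<close>
  define H where "H l = zero_locus {Const (m j1 b) * \<mu> j2 - Const (m j2 b + l * d $ i) * \<mu> j1}" for l
  have hom_H: "homogeneous 1 (Const (m j1 b) * \<mu> j2 - Const (m j2 b + l * d $ i) * \<mu> j1)" for l
    using homogeneous_mult[OF homogeneous_Const hom] by (intro homogeneous_diff) auto
  then have closed_H: "zariski_closed (H l)" for l
    unfolding H_def zariski_closed_def by blast
  have H: "point v \<in> H l \<longleftrightarrow> m j1 b * m j2 v = (m j2 b + l * d $ i) * m j1 v" if "v \<noteq> 0" for v l
    using vanishes_at_point[OF hom_H that] by (simp add: H_def zero_locus_def poly_eval_simps m_def)
  have infinite_Z: "infinite (?Z \<inter> H l)" if l: "l \<in> \<Lambda>" for l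
  proof -
    have "\<forall>r\<in>M l. \<exists>t. poly_eval g (x l r + t *s d) = 0 \<and> poly_eval h (x l r + t *s d) = 0"
      using common by (simp add: M_def)
    then obtain t where t:
      "\<forall>r\<in>M l. poly_eval g (x l r + t r *s d) = 0 \<and> poly_eval h (x l r + t r *s d) = 0"
      by (rule bchoice[THEN exE])
    define y where "y r = x l r + t r *s d" for r
    have y: "m j1 (y r) = m j1 b" "m j2 (y r) = m j2 b + l * d $ i" "m j3 (y r) = m j3 b + r * d $ i" for r
      using j(2) by (auto simp: y_def x_def m axis_def algebra_simps)
    have y0: "y r \<noteq> 0" for r
      using y(1)[of r] b(2) by (auto simp: m)
    \<comment> \<open>The common value of \<open>m j1\<close> forces two proportional
      representatives to agree, and \<open>m j3\<close> then recovers \<open>r\<close>.\<close>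
    have "inj_on (\<lambda>r. point (y r)) (M l)"
    proof (rule inj_onI)
      fix r r' assume "point (y r) = point (y r')"
      then obtain a where a: "y r = a *s y r'"
        using point_eqD y0 by metis
      then have "m j1 b = a * m j1 b"
        using m_scale[of j1 a "y r'"] y(1) by metis
      then have "a = 1"
        using b(2) by simp
      then have "m j3 (y r) = m j3 (y r')"
        using a by simp
      then show "r = r'"
        using y(3) i by simp
    qed
    then have "infinite ((\<lambda>r. point (y r)) ` M l)"
      using inf(2)[OF l] finite_imageD by blast
    moreover have "(\<lambda>r. point (y r)) ` M l \<subseteq> ?Z \<inter> H l"
      using t by (auto simp: Z[OF y0] H[OF y0] y) (simp_all add: y_def)
    ultimately show ?thesis
      using finite_subset by blast
  qed
  have finite_Z: "finite (?Z \<inter> H l \<inter> H l')" if "l \<noteq> l'" for l l'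
  proof -
    let ?T = "{t. poly (on_line (axis j3 1) d g) t = 0}"
    have "on_line (axis j3 1) d g \<noteq> 0"
      using coeff_on_line[OF g(2), of "axis j3 1" d] d by auto
    then have "finite ?T"
      by (rule poly_roots_finite)
    moreover have "?Z \<inter> H l \<inter> H l' \<subseteq> (\<lambda>t. point (axis j3 1 + t *s d)) ` ?T"
    proof
      fix p assume p: "p \<in> ?Z \<inter> H l \<inter> H l'"
      obtain v where v: "v \<noteq> 0" "p = point v"
        by (rule point_cases)
      have eqs: "m j1 b * m j2 v = (m j2 b + l * d $ i) * m j1 v"
        "m j1 b * m j2 v = (m j2 b + l' * d $ i) * m j1 v" and gv: "poly_eval g v = 0"
        using p unfolding v(2) Int_iff H[OF v(1)] Z[OF v(1)] by blast+
      have "(m j2 b + l * d $ i) * m j1 v = (m j2 b + l' * d $ i) * m j1 v"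
        using eqs(1,2) by (rule trans[OF sym])
      then have m1: "m j1 v = 0"
        using that i by simp
      then have m2: "m j2 v = 0"
        using eqs b(2) by simp
      \<comment> \<open>As \<open>m j1\<close> and \<open>m j2\<close> vanish, \<open>v\<close> lies
        in the span of \<open>d\<close> and \<open>axis j3 1\<close>. Here \<beta> is nonzero
        because g(d) is, so the point comes from a root of g on the line
        \<open>axis j3 1 + t *s d\<close>.\<close>
      define \<alpha> \<beta> where "\<alpha> = v $ i / d $ i" and "\<beta> = m j3 v / d $ i"
      have "v $ jj = (\<alpha> *s d + \<beta> *s axis j3 1) $ jj" for jj
      proof -
        consider "jj = i" | "jj = j1" | "jj = j2" | "jj = j3"
          using j(1) by blast
        then show ?thesis
          using i j(2) m1 m2 by cases (auto simp: \<alpha>_def \<beta>_def m axis_def field_simps)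
      qed
      then have v_eq: "v = \<alpha> *s d + \<beta> *s axis j3 1"
        by (simp add: vec_eq_iff)
      have "\<beta> \<noteq> 0"
      proof
        assume "\<beta> = 0"
        then have "\<alpha> ^ k * poly_eval g d = 0"
          using gv poly_eval_scale[OF g(2)] by (simp add: v_eq)
        then show False
          using d v(1) \<open>\<beta> = 0\<close> by (simp add: v_eq)
      qed
      then have scale: "v = \<beta> *s (axis j3 1 + (\<alpha> / \<beta>) *s d)"
        by (simp add: v_eq vector_add_ldistrib vector_smult_assoc add.commute)
      have "\<beta> ^ k * poly_eval g (axis j3 1 + (\<alpha> / \<beta>) *s d) = 0"
        using gv by (subst (asm) scale) (simp only: poly_eval_scale[OF g(2)])
      then have "poly_eval g (axis j3 1 + (\<alpha> / \<beta>) *s d) = 0"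
        using \<open>\<beta> \<noteq> 0\<close> by simp
      moreover have "p = point (axis j3 1 + (\<alpha> / \<beta>) *s d)"
      proof -
        have "axis j3 1 + (\<alpha> / \<beta>) *s d \<noteq> 0"
          using scale v(1) by (metis vector_smult_rzero)
        then show ?thesis
          using point_scale \<open>\<beta> \<noteq> 0\<close> scale v(2) by metis
      qed
      ultimately show "p \<in> (\<lambda>t. point (axis j3 1 + t *s d)) ` ?T"
        by (auto simp: poly_on_line)
    qed
    ultimately show ?thesis
      using finite_surj by blast
  qed
  have "zariski_closed ?Z"
    unfolding zariski_closed_def using g(2) h by (intro exI[of _ "{g, h}"]) auto
  then have "\<exists>p E C. irreducible_closed E \<and> irreducible_closed C \<and> {p} \<subset> E \<and> E \<subset> C \<and> C \<subseteq> ?Z"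
    by (rule exists_chain[OF _ inf(1) closed_H]) (erule infinite_Z, erule finite_Z)
  then obtain p E C where "irreducible_closed E" "irreducible_closed C" "{p} \<subset> E" "E \<subset> C" "C \<subseteq> ?Z"
    by blast
  then show ?thesis
    by (rule zariski_dim_ge_2)
qed

section \<open>Linear relations between the forms\<close>

text \<open>The value of the 2-form dg \<and> dh on the constant vector fields \<open>u\<close> and
  \<open>w\<close>.\<close>

definition minor :: "complex ^ coord \<Rightarrow> complex ^ coord \<Rightarrow> poly4 \<Rightarrow> poly4 \<Rightarrow> poly4" where
  "minor u w g h = dir_deriv u g * dir_deriv w h - dir_deriv w g * dir_deriv u h"

lemma pencil_form_pair:
  assumes "a < b"
  shows "pencil_form g h $ {a, b} = partial_deriv a g * partial_deriv b h - partial_deriv b g * partial_deriv a h"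
proof -
  have sign: "shuffle_sign {a} {b} = 1" "shuffle_sign {b} {a} = - 1"
  proof -
    have inversions: "{(i, j). i \<in> {a} \<and> j \<in> {b} \<and> j < i} = {}"
      "{(i, j). i \<in> {b} \<and> j \<in> {a} \<and> j < i} = {(b, a)}"
      using assms by auto
    show "shuffle_sign {a} {b} = 1" "shuffle_sign {b} {a} = - 1"
      unfolding shuffle_sign_def inversions by simp_all
  qed
  have "Pow {a, b} = {{}, {a}, {b}, {a, b}}"
    by blast
  moreover have "{a, b} - {a} = {b}" "{a, b} - {b} = {a}"
    using assms by auto
  moreover have "\<nexists>i. {a, b} = {i}"
    using assms by auto
  ultimately show ?thesis
    using assms by (simp add: pencil_form_def wedge_def dfun_component sign)
qed

lemma pencil_form_at_component:
  "pencil_form_at l g h $ K = (if l \<in> K then shuffle_sign {l} (K - {l}) * pencil_form g h $ (K - {l}) else 0)"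
proof -
  have "pencil_form_at l g h $ K = (\<Sum>I\<in>Pow K. if I = {l}
      then shuffle_sign {l} (K - {l}) * pencil_form g h $ (K - {l}) else 0)"
    unfolding pencil_form_at_def wedge_def dfun_Var vec_lambda_beta by (rule sum.cong) auto
  also have "\<dots> = (if {l} \<in> Pow K then shuffle_sign {l} (K - {l}) * pencil_form g h $ (K - {l}) else 0)"
    by (rule sum.delta) simp
  finally show ?thesis
    by simp
qed

lemma pencil_form_at_triple:
  assumes "a < b" "b < c"
  shows "pencil_form_at a g h $ {a, b, c} = pencil_form g h $ {b, c}"
    and "pencil_form_at b g h $ {a, b, c} = - pencil_form g h $ {a, c}"
    and "pencil_form_at c g h $ {a, b, c} = pencil_form g h $ {a, b}"
    and "l \<notin> {a, b, c} \<Longrightarrow> pencil_form_at l g h $ {a, b, c} = 0"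
proof -
  have inversions: "{(i, j). i \<in> {a} \<and> j \<in> {b, c} \<and> j < i} = {}"
      "{(i, j). i \<in> {b} \<and> j \<in> {a, c} \<and> j < i} = {(b, a)}"
      "{(i, j). i \<in> {c} \<and> j \<in> {a, b} \<and> j < i} = {(c, a), (c, b)}"
    using assms by auto
  have "shuffle_sign {a} {b, c} = 1" "shuffle_sign {b} {a, c} = - 1" "shuffle_sign {c} {a, b} = 1"
    unfolding shuffle_sign_def inversions using assms by simp_all
  moreover have "{a, b, c} - {a} = {b, c}" "{a, b, c} - {b} = {a, c}" "{a, b, c} - {c} = {a, b}"
    using assms by auto
  ultimately show "pencil_form_at a g h $ {a, b, c} = pencil_form g h $ {b, c}"
    "pencil_form_at b g h $ {a, b, c} = - pencil_form g h $ {a, c}"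
    "pencil_form_at c g h $ {a, b, c} = pencil_form g h $ {a, b}"
    "l \<notin> {a, b, c} \<Longrightarrow> pencil_form_at l g h $ {a, b, c} = 0"
    by (simp_all add: pencil_form_at_component)
qed

abbreviation related :: "complex ^ coord \<Rightarrow> poly4 \<Rightarrow> poly4 \<Rightarrow> bool" where
  "related c g h \<equiv> (\<Sum>i\<in>UNIV. form_scale (c $ i) (pencil_form_at i g h)) = 0"

text \<open>For an increasing triple this is one component of the relation d\<ell> \<and> dg \<and>
  dh = 0. The left-hand side alternates in \<open>i\<close>, \<open>j\<close>, \<open>l\<close>,
  which covers the other orders.\<close>

lemma related_triple:
  assumes rel: "related c g h"
  shows "c $ i * poly_eval (minor (axis j 1) (axis l 1) g h) v
    - c $ j * poly_eval (minor (axis i 1) (axis l 1) g h) v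
    + c $ l * poly_eval (minor (axis i 1) (axis j 1) g h) v = 0"
proof -
  define M where "M a b = poly_eval (minor (axis a 1) (axis b 1) g h) v" for a b
  have anti: "M b a = - M a b" for a b
    by (simp add: M_def minor_def poly_eval_simps)
  have M: "M a b = poly_eval (pencil_form g h $ {a, b}) v" if "a < b" for a b
    by (simp add: M_def minor_def pencil_form_pair[OF that] partial_deriv_eq_dir_deriv)
  have sorted: "c $ a * M b d - c $ b * M a d + c $ d * M a b = 0" if "a < b" "b < d" for a b d
  proof -
    let ?K = "{a, b, d}"
    have "(\<Sum>i\<in>UNIV. Const (c $ i) * pencil_form_at i g h $ ?K) = 0"
      using arg_cong[OF rel, of "\<lambda>\<omega>. \<omega> $ ?K"] by (simp add: form_scale_def)
    then have "(\<Sum>i\<in>?K. Const (c $ i) * pencil_form_at i g h $ ?K) = 0"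
      by (subst (asm) sum.mono_neutral_right[of UNIV ?K]) (auto simp: pencil_form_at_component)
    then have "poly_eval (\<Sum>i\<in>?K. Const (c $ i) * pencil_form_at i g h $ ?K) v = 0"
      by (simp add: poly_eval_0)
    moreover have "a \<noteq> b" "a \<noteq> d" "b \<noteq> d"
      using that by auto
    ultimately show ?thesis
      using that M[OF that(1)] M[OF that(2)] M[OF less_trans[OF that]]
      by (simp add: pencil_form_at_triple[OF that] poly_eval_simps algebra_simps)
  qed
  have diag: "M a a = 0" for a
    using anti[of a a] by simp
  consider "i = j \<or> i = l \<or> j = l" | "i < j" "j < l" | "i < l" "l < j" | "j < i" "i < l"
    | "j < l" "l < i" | "l < i" "i < j" | "l < j" "j < i"
    by (metis linorder_less_linear)
  then have "c $ i * M j l - c $ j * M i l + c $ l * M i j = 0"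
  proof cases
    case 1
    then show ?thesis
      using diag anti[of i j] anti[of i l] anti[of j l] by auto
  next
    case 2
    then show ?thesis
      by (rule sorted)
  next
    case 3
    show ?thesis
      using sorted[OF 3] anti[of l j] by algebra
  next
    case 4
    show ?thesis
      using sorted[OF 4] anti[of j i] by algebra
  next
    case 5
    show ?thesis
      using sorted[OF 5] anti[of l i] anti[of j i] by algebra
  next
    case 6
    show ?thesis
      using sorted[OF 6] anti[of l i] anti[of l j] by algebra
  next
    case 7
    show ?thesis
      using sorted[OF 7] anti[of l j] anti[of l i] anti[of j i] by algebra
  qed
  then show ?thesis
    by (simp add: M_def)
qed

lemma poly_eval_minor_sum_left:
  "poly_eval (minor u w g h) v = (\<Sum>i\<in>UNIV. u $ i * poly_eval (minor (axis i 1) w g h) v)"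
proof -
  have "poly_eval (dir_deriv u f) v = (\<Sum>i\<in>UNIV. u $ i * poly_eval (dir_deriv (axis i 1) f) v)" for f
    by (simp add: poly_eval_dir_deriv[of u] partial_deriv_eq_dir_deriv)
  then show ?thesis
    unfolding minor_def poly_eval_simps
    by (simp add: sum_distrib_right sum_distrib_left sum_subtractf right_diff_distrib ac_simps)
qed

lemma minor_swap: "minor w u g h = - minor u w g h"
  by (simp add: minor_def)

lemma poly_eval_minor_sum_right:
  "poly_eval (minor u w g h) v = (\<Sum>i\<in>UNIV. w $ i * poly_eval (minor u (axis i 1) g h) v)"
  using poly_eval_minor_sum_left[of w u g h v]
  by (simp add: minor_swap[of w] minor_swap[of "axis _ _" u] poly_eval_simps sum_negf)

text \<open>The contraction of \<open>d\<ell> \<and> dg \<and> dh\<close> with three vectors.\<close>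

lemma related_minors:
  assumes rel: "related c g h"
  shows "poly_eval (linear_poly c) x * poly_eval (minor w u g h) v
    - poly_eval (linear_poly c) w * poly_eval (minor x u g h) v
    + poly_eval (linear_poly c) u * poly_eval (minor x w g h) v = 0"
proof -
  let ?M = "\<lambda>x w. poly_eval (minor x w g h) v" and ?e = "\<lambda>i. axis i 1 :: complex ^ coord"
  let ?l = "poly_eval (linear_poly c)"
  have 1: "c $ i * ?M (?e j) u - c $ j * ?M (?e i) u + ?l u * ?M (?e i) (?e j) = 0" for i j
  proof -
    have "(\<Sum>l\<in>UNIV. u $ l * (c $ i * ?M (?e j) (?e l) - c $ j * ?M (?e i) (?e l) + c $ l * ?M (?e i) (?e j)))
        = c $ i * ?M (?e j) u - c $ j * ?M (?e i) u + ?l u * ?M (?e i) (?e j)"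
      unfolding poly_eval_minor_sum_right[of _ u] poly_eval_linear_poly by (simp add: sum_coord algebra_simps)
    then show ?thesis
      unfolding related_triple[OF rel] by simp
  qed
  have 2: "c $ i * ?M w u - ?l w * ?M (?e i) u + ?l u * ?M (?e i) w = 0" for i
  proof -
    have "(\<Sum>j\<in>UNIV. w $ j * (c $ i * ?M (?e j) u - c $ j * ?M (?e i) u + ?l u * ?M (?e i) (?e j)))
        = c $ i * ?M w u - ?l w * ?M (?e i) u + ?l u * ?M (?e i) w"
      unfolding poly_eval_minor_sum_left[of w u] poly_eval_minor_sum_right[of _ w] poly_eval_linear_poly[of _ w]
      by (simp add: sum_coord algebra_simps)
    then show ?thesis
      unfolding 1 by simp
  qed
  have "(\<Sum>i\<in>UNIV. x $ i * (c $ i * ?M w u - ?l w * ?M (?e i) u + ?l u * ?M (?e i) w))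
      = ?l x * ?M w u - ?l w * ?M x u + ?l u * ?M x w"
    unfolding poly_eval_minor_sum_left[of x u] poly_eval_minor_sum_left[of x w] poly_eval_linear_poly[of _ x]
    by (simp add: sum_coord algebra_simps)
  then show ?thesis
    unfolding 2 by simp
qed

text \<open>Contract d\<ell> \<and> dg \<and> dh with \<open>u\<close>, \<open>w\<close> and a
  vector \<open>x\<close> off ker \<ell>: only \<ell>(x) times the minor survives. So dg \<and> dh
  vanishes on ker \<ell>.\<close>

lemma related_minor_eq_0:
  assumes rel: "related c g h" and c: "c \<noteq> 0"
    and "poly_eval (linear_poly c) u = 0" "poly_eval (linear_poly c) w = 0"
  shows "minor w u g h = 0"
proof -
  obtain x where "poly_eval (linear_poly c) x \<noteq> 0"
    using c ex_poly_eval_nonzero linear_poly_eq_0_iff by blast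
  then have "poly_eval (minor w u g h) v = 0" for v
    using related_minors[OF rel, of x w u v] assms by simp
  then show ?thesis
    by (rule poly_eval_eq_0_imp)
qed

section \<open>Charts\<close>

lemma dehomogenize_conv_subst: "dehomogenize i = subst Const (\<lambda>j. if j = i then 1 else Var j)"
proof
  fix f
  have "Poly_Mapping.single (Poly_Mapping.update i 0 m) a
      = Const a * (\<Prod>j\<in>UNIV. (if j = i then 1 else Var j) ^ Poly_Mapping.lookup m j)" for m a
    unfolding single_conv_prod_Var
    by (intro arg_cong2[of _ _ _ _ "(*)"] prod.cong) (auto simp: lookup_update)
  then show "dehomogenize i f = subst Const (\<lambda>j. if j = i then 1 else Var j) f"
    by (simp add: dehomogenize_def subst_def)
qed

lemmas dehomogenize_simps =
  Const.subst_simps[of "\<lambda>j. if j = i then 1 else Var j" for i, folded dehomogenize_conv_subst]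

lemma dehomogenize_in_chart_ring: "dehomogenize i f \<in> chart_ring i"
proof -
  have "Poly_Mapping.lookup m i = 0" if m: "m \<in> Poly_Mapping.keys (dehomogenize i f)" for m
  proof -
    obtain n where "m \<in> Poly_Mapping.keys (Poly_Mapping.single (Poly_Mapping.update i 0 n) (Poly_Mapping.lookup f n))"
      using subsetD[OF keys_sum m[unfolded dehomogenize_def]] by blast
    then show ?thesis
      by (auto simp: lookup_update split: if_splits)
  qed
  then show ?thesis
    by (simp add: chart_ring_def)
qed

lemma linear_poly_in_chart_ideal:
  assumes "linear_poly c ^ e \<in> I" "reduced_scheme I"
  shows "dehomogenize i (linear_poly c) \<in> chart_ideal i I"
proof -
  have "dehomogenize i (linear_poly c) ^ e \<in> chart_ideal i I"
    using assms(1) unfolding chart_ideal_def by (simp flip: dehomogenize_simps)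
  then show ?thesis
    using assms(2) dehomogenize_in_chart_ring unfolding reduced_scheme_def by blast
qed

lemma subscheme_of_surface:
  assumes "\<And>i. dehomogenize i f \<in> chart_ideal i (base_locus g h)"
  shows "subscheme_of (base_locus g h) (surface f)"
  unfolding subscheme_of_def
proof (intro allI subsetI)
  fix i p assume "p \<in> chart_ideal i (surface f)"
  then obtain a where p: "p = dehomogenize i (a * f)"
    by (auto simp: chart_ideal_def surface_def ideal.span_singleton)
  obtain r where r: "r \<in> base_locus g h" "dehomogenize i f = dehomogenize i r"
    using assms[of i] by (auto simp: chart_ideal_def)
  have "a * r \<in> base_locus g h"
    using r(1) unfolding base_locus_def by (rule ideal.span_scale)
  moreover have "p = dehomogenize i (a * r)"
    by (simp only: p r(2) dehomogenize_simps)
  ultimately show "p \<in> chart_ideal i (base_locus g h)"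
    by (auto simp: chart_ideal_def)
qed

section \<open>At most one linear relation\<close>

lemma euler:
  assumes "homogeneous k f"
  shows "poly_eval (dir_deriv v f) v = of_nat k * poly_eval f v"
proof -
  have "poly (on_line v v f) = poly (smult (poly_eval f v) ([:1, 1:] ^ k))"
  proof
    fix s
    have "v + s *s v = (1 + s) *s v"
      by (simp add: vec_eq_iff algebra_simps)
    then have "poly (on_line v v f) s = (1 + s) ^ k * poly_eval f v"
      by (simp only: poly_on_line poly_eval_scale[OF assms])
    then show "poly (on_line v v f) s = poly (smult (poly_eval f v) ([:1, 1:] ^ k)) s"
      by simp
  qed
  then have "on_line v v f = smult (poly_eval f v) ([:1, 1:] ^ k)"
    by (simp add: poly_eq_poly_eq_iff)
  then have "on_line v v (dir_deriv v f) = pderiv (smult (poly_eval f v) ([:1, 1:] ^ k))"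
    by (simp flip: pderiv_on_line)
  then have "poly (on_line v v (dir_deriv v f)) 0 = of_nat k * poly_eval f v"
    by (simp add: pderiv_smult pderiv_power pderiv_pCons)
  then show ?thesis
    by (simp add: poly_on_line)
qed

lemma homogeneous_dir_deriv:
  assumes "homogeneous k f"
  shows "homogeneous (k - 1) (dir_deriv u f)"
proof -
  have "mon_degree m = k - 1" if "m \<in> Poly_Mapping.keys (partial_deriv i f)" for m i
  proof -
    have "m + Poly_Mapping.single i 1 \<in> Poly_Mapping.keys f"
      using that by (auto simp: in_keys_iff lookup_partial_deriv)
    then have "mon_degree (m + Poly_Mapping.single i 1) = k"
      using assms by (simp add: homogeneous_def)
    then show ?thesis
      by (simp add: mon_degree_add mon_degree_single)
  qed
  then have "homogeneous (k - 1) (partial_deriv i f)" for i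
    by (simp add: homogeneous_def)
  then show ?thesis
    unfolding dir_deriv_def using homogeneous_mult[OF homogeneous_Const]
    by (auto intro!: homogeneous_sum)
qed

text \<open>On the line through the origin in a direction \<open>d\<close> with f(d) nonzero,
  \<open>f\<close> has degree at most \<open>l\<close>, whereas the k-th coefficient of its divisor
  \<open>g\<close> is g(d), which is nonzero as well.\<close>

lemma homogeneous_dvd_imp_eq_0:
  assumes "homogeneous k g" "homogeneous l f" "l < k" "g dvd f"
  shows "f = 0"
proof (rule ccontr)
  assume "f \<noteq> 0"
  then obtain d where d: "poly_eval f d \<noteq> 0"
    using ex_poly_eval_nonzero by blast
  obtain r where r: "f = g * r"
    using assms(4) by (rule dvdE)
  have eq: "on_line 0 d f = on_line 0 d g * on_line 0 d r"
    by (simp only: r on_line_simps)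
  have "on_line 0 d f \<noteq> 0"
    using coeff_on_line[OF assms(2), of 0 d] d by auto
  then have "degree (on_line 0 d g) \<le> degree (on_line 0 d f)"
    using eq by (simp add: degree_mult_eq)
  also have "\<dots> \<le> l"
    by (rule degree_on_line[OF assms(2)])
  finally have "coeff (on_line 0 d g) k = 0"
    using assms(3) by (simp add: coeff_eq_0)
  then have "poly_eval g d = 0"
    by (simp add: coeff_on_line[OF assms(1)])
  then show False
    using d by (simp add: r poly_eval_simps)
qed

text \<open>By Euler's formula \<open>h D\<^sub>v g = g D\<^sub>v h\<close>.\<close>

lemma dir_deriv_eq_0_if_minors_eq_0:
  assumes k: "k \<ge> 1" and g: "g \<noteq> 0" "homogeneous k g" and h: "h \<noteq> 0" "homogeneous k h"
    and nzd: "\<And>q. g dvd h * q \<Longrightarrow> g dvd q"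
    and minors: "\<And>u. minor v u g h = 0"
  shows "dir_deriv v g = 0" "dir_deriv v h = 0"
proof -
  have eq: "h * dir_deriv v g = g * dir_deriv v h"
    unfolding poly_eq_iff_poly_eval
  proof
    fix x
    have "of_nat k * (poly_eval h x * poly_eval (dir_deriv v g) x)
        = of_nat k * (poly_eval g x * poly_eval (dir_deriv v h) x)"
      using arg_cong[OF minors[of x], of "\<lambda>f. poly_eval f x"]
      by (simp add: minor_def poly_eval_simps euler[OF g(2)] euler[OF h(2)] ac_simps)
    then show "poly_eval (h * dir_deriv v g) x = poly_eval (g * dir_deriv v h) x"
      using k by (simp add: poly_eval_simps)
  qed
  then have "g dvd h * dir_deriv v g"
    by simp
  then have "g dvd dir_deriv v g"
    by (rule nzd)
  then show "dir_deriv v g = 0"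
    using homogeneous_dvd_imp_eq_0[OF g(2) homogeneous_dir_deriv[OF g(2)]] k by simp
  then show "dir_deriv v h = 0"
    using eq g(1) by simp
qed

text \<open>If \<open>g\<close> and \<open>h\<close> are invariant under translation by \<open>v\<close>, then both vanish to order \<open>k\<close> at
  the point \<open>v\<close>, whereas a linear form in their ideal would vanish there only to first order.\<close>

lemma linear_poly_not_in_chart_ideal:
  assumes k: "k \<ge> 2" and g: "homogeneous k g" "dir_deriv v g = 0" and h: "homogeneous k h" "dir_deriv v h = 0"
    and v: "v $ i = 1" "poly_eval (linear_poly c) v = 0" and c: "c \<noteq> 0"
  shows "dehomogenize i (linear_poly c) \<notin> chart_ideal i (base_locus g h)"
proof
  assume "dehomogenize i (linear_poly c) \<in> chart_ideal i (base_locus g h)"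
  then obtain A B where AB: "dehomogenize i (linear_poly c) = dehomogenize i (A * g + B * h)"
    by (auto simp: chart_ideal_def base_locus_def span_pair_iff)
  \<comment> \<open>Invariance along \<open>v\<close> turns f(v + s u) into f(s u), which is s^k
    f(u).\<close>
  have cone: "on_line v u f = monom (poly_eval f u) k" if "homogeneous k f" "dir_deriv v f = 0" for f u
  proof -
    have "poly (on_line v u f) s = poly (monom (poly_eval f u) k) s" for s
      using poly_eval_translate[OF that(2), of "s *s u" 1]
      by (simp add: poly_on_line poly_monom poly_eval_scale[OF that(1)] add.commute)
    then show ?thesis
      by (simp add: poly_eq_poly_eq_iff[symmetric] fun_eq_iff)
  qed
  have "c $ j = 0" if j: "j \<noteq> i" for j
  proof -
    let ?u = "axis j 1 :: complex ^ coord"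
    have "poly (on_line v ?u (linear_poly c)) s = poly (on_line v ?u (A * g + B * h)) s" for s
    proof -
      \<comment> \<open>Moving along another axis keeps the i-th coordinate 1, where
        dehomogenization does not change values.\<close>
      have "(v + s *s ?u) $ i = 1"
        using v(1) j by (simp add: axis_def)
      then show ?thesis
        unfolding poly_on_line using AB poly_eval_dehomogenize by metis
    qed
    then have "on_line v ?u (linear_poly c) = on_line v ?u (A * g + B * h)"
      by (simp add: poly_eq_poly_eq_iff[symmetric] fun_eq_iff)
    then have "coeff (on_line v ?u (linear_poly c)) 1 = 0"
      using k by (simp add: on_line_simps cone[OF g] cone[OF h] mult.commute[of _ "monom _ _"] coeff_monom_mult)
    then show ?thesis
      using coeff_on_line[OF homogeneous_linear_poly] by (simp add: poly_eval_linear_poly_axis)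
  qed
  then have "c = axis i (c $ i)"
    by (auto simp: vec_eq_iff axis_def)
  moreover have "c $ i = 0"
  proof -
    have "poly_eval (linear_poly c) v = (\<Sum>j\<in>UNIV. if j = i then c $ i else 0)"
      unfolding poly_eval_linear_poly by (intro sum.cong) (auto simp: v(1) \<open>\<And>j. j \<noteq> i \<Longrightarrow> c $ j = 0\<close>)
    then show ?thesis
      using v(2) by simp
  qed
  ultimately show False
    using c by (simp add: axis_eq_0_iff)
qed

text \<open>Proportionality of relations in normalised form: two independent ones would combine to a
  nonzero one with i-th coefficient 0. At a common zero \<open>v\<close>, the relation
  \<open>c'\<close> kills the minor of \<open>v\<close> and e_i; contracting \<open>c\<close> with
  e_i, \<open>v\<close> and any \<open>u\<close> then kills the minor of \<open>v\<close> and
  \<open>u\<close>.\<close>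

lemma related_unique:
  assumes k: "k \<ge> 2" and g: "g \<noteq> 0" "homogeneous k g" and h: "h \<noteq> 0" "homogeneous k h"
    and nzd: "\<And>q. g dvd h * q \<Longrightarrow> g dvd q"
    and chart: "\<And>i. dehomogenize i (linear_poly c) \<in> chart_ideal i (base_locus g h)"
    and rel: "related c g h" "related c' g h"
    and i: "c $ i \<noteq> 0" "c' $ i = 0"
  shows "c' = 0"
proof (rule ccontr)
  assume "c' \<noteq> 0"
  then obtain j where j: "c' $ j \<noteq> 0"
    by (auto simp: vec_eq_iff)
  obtain l where l: "l \<noteq> i" "l \<noteq> j"
    by (metis coord.distinct(1,3,7))
  have ij: "i \<noteq> j"
    using i j by auto
  \<comment> \<open>\<beta> solves c'(v) = 0, as \<open>c'\<close> has no i-th coefficient, and then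
    \<alpha> solves c(v) = 0. The coordinate \<open>l\<close> of \<open>v\<close> is 1 and names the
    chart used in the contradiction.\<close>
  define \<beta> where "\<beta> = - c' $ l / c' $ j"
  define \<alpha> where "\<alpha> = - (c $ l + \<beta> * c $ j) / c $ i"
  define v :: "complex ^ coord" where "v = axis l 1 + \<alpha> *s axis i 1 + \<beta> *s axis j 1"
  have "v $ l = 1"
    using l by (simp add: v_def axis_def)
  moreover have "poly_eval (linear_poly c) v = 0" "poly_eval (linear_poly c') v = 0"
    using i j by (simp_all add: v_def poly_eval_linear_poly_add poly_eval_linear_poly_diff
        poly_eval_linear_poly_scale poly_eval_linear_poly_axis \<alpha>_def \<beta>_def)
  ultimately have v: "v $ l = 1" "poly_eval (linear_poly c) v = 0" "poly_eval (linear_poly c') v = 0"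
    by simp_all
  let ?x = "axis i 1 :: complex ^ coord"
  have x: "poly_eval (linear_poly c') ?x = 0" "poly_eval (linear_poly c) ?x \<noteq> 0"
    using i by (simp_all add: poly_eval_linear_poly_axis)
  have vx: "minor v ?x g h = 0"
    using related_minor_eq_0[OF rel(2) \<open>c' \<noteq> 0\<close> x(1) v(3)] .
  have "minor v u g h = 0" for u
  proof (rule poly_eval_eq_0_imp)
    fix p
    have "poly_eval (minor ?x v g h) p = 0"
      using vx by (simp add: minor_swap[of ?x v] poly_eval_simps)
    then show "poly_eval (minor v u g h) p = 0"
      using related_minors[OF rel(1), of ?x v u p] v(2) x(2) by simp
  qed
  then have "dir_deriv v g = 0" "dir_deriv v h = 0"
    using dir_deriv_eq_0_if_minors_eq_0[OF _ g h nzd, of v] k by simp_all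
  moreover have "c \<noteq> 0"
    using i(1) by auto
  ultimately show False
    using linear_poly_not_in_chart_ideal[OF k g(2) _ h(2) _ v(1,2)] chart by blast
qed

text \<open>A relation that omits the form of index \<open>i\<close> is trivial, so the other three
  forms are independent.\<close>

lemma dim_pencil_forms:
  assumes uniq: "\<And>c. related c g h \<Longrightarrow> c $ i = 0 \<Longrightarrow> c = 0"
  shows "forms.dim (range (\<lambda>j. pencil_form_at j g h)) \<in> {3, 4}"
proof -
  let ?\<omega> = "\<lambda>j. pencil_form_at j g h"
  let ?S = "range ?\<omega>" and ?J = "UNIV - {i}"
  have card: "card (UNIV :: coord set) = 4"
    by (simp add: UNIV_coord)
  \<comment> \<open>Independence is a property of sets, so coincidences are excluded separately:
    equal forms of indices \<open>a\<close> and \<open>b\<close> would give the relation e_a -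
    e_b.\<close>
  have inj: "inj_on ?\<omega> ?J"
  proof (rule inj_onI, rule ccontr)
    fix a b assume ab: "a \<in> ?J" "b \<in> ?J" "?\<omega> a = ?\<omega> b" "a \<noteq> b"
    let ?c = "axis a 1 - axis b 1 :: complex ^ coord"
    have "form_scale (?c $ j) (?\<omega> j) = (if j = a then ?\<omega> a else 0) - (if j = b then ?\<omega> b else 0)" for j
      using ab(4) by (simp add: axis_def)
    then have "related ?c g h"
      using ab(3) by (simp add: sum_subtractf)
    moreover have "?c $ i = 0"
      using ab by (simp add: axis_def)
    ultimately have "?c = 0"
      by (rule uniq)
    then have "?c $ a = 0"
      by simp
    then show False
      using ab(4) by (simp add: axis_def)
  qed
  have indep: "\<not> forms.dependent (?\<omega> ` ?J)"
  proof
    assume "forms.dependent (?\<omega> ` ?J)"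
    then obtain u where u: "\<exists>x\<in>?\<omega> ` ?J. u x \<noteq> 0" "(\<Sum>x\<in>?\<omega> ` ?J. form_scale (u x) x) = 0"
      by (auto simp: forms.dependent_finite)
    define c :: "complex ^ coord" where "c = (\<chi> j. if j = i then 0 else u (?\<omega> j))"
    have "(\<Sum>j\<in>UNIV. form_scale (c $ j) (?\<omega> j)) = (\<Sum>j\<in>?J. form_scale (u (?\<omega> j)) (?\<omega> j))"
      by (rule sum.mono_neutral_cong_right) (auto simp: c_def)
    also have "\<dots> = 0"
      using u(2) by (simp add: sum.reindex[OF inj])
    finally have "c = 0"
      by (rule uniq) (simp add: c_def)
    have "u (?\<omega> j) = 0" if "j \<noteq> i" for j
      using arg_cong[OF \<open>c = 0\<close>, of "\<lambda>c. c $ j"] that by (simp add: c_def)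
    then show False
      using u(1) by blast
  qed
  obtain B where B: "B \<subseteq> ?S" "?S \<subseteq> forms.span B" "card B = forms.dim ?S"
    using forms.basis_exists[of ?S] by metis
  have "card (?\<omega> ` ?J) \<le> card B"
    using forms.independent_span_bound[of B "?\<omega> ` ?J"] indep B finite_subset[of B ?S] by auto
  moreover have "card (?\<omega> ` ?J) = 3"
    using inj card by (simp add: card_image)
  moreover have "card B \<le> card ?S" "card ?S \<le> 4"
    using B(1) card_image_le[of UNIV ?\<omega>] card by (auto intro: card_mono)
  ultimately show ?thesis
    using B(3) by auto
qed

theorem theorem6p1:
  fixes g h :: poly4 and k :: nat
  assumes "k \<ge> 2"
    and "g \<noteq> 0" "homogeneous k g"
    and "h \<noteq> 0" "homogeneous k h"
    and "curve_scheme (base_locus g h)"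
    and "reduced_scheme (base_locus g h)"
  shows "(\<forall>c :: complex ^ coord.
            c \<noteq> 0 \<and>
            form_scale (c $ Cx) (pencil_form_at Cx g h) + form_scale (c $ Cy) (pencil_form_at Cy g h) +
            form_scale (c $ Cz) (pencil_form_at Cz g h) + form_scale (c $ Ct) (pencil_form_at Ct g h) = 0
            \<longrightarrow> subscheme_of (base_locus g h) (surface (linear_poly c)))
         \<and> forms.dim (forms.span {pencil_form_at Cx g h, pencil_form_at Cy g h,
                                   pencil_form_at Cz g h, pencil_form_at Ct g h}) \<in> {3, 4}"
proof -
  have nzd: "g dvd q" if "g dvd h * q" for q
  proof (rule ccontr)
    assume "\<not> g dvd q"
    then have "zariski_dim (zero_locus {g, h}) \<ge> 2"
      using zariski_dim_zero_divisor[OF _ assms(2,3,5) that] assms(1) by simp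
    then show False
      using assms(6) by (simp add: curve_scheme_def base_locus_def zero_locus_span)
  qed
  have chart: "dehomogenize i (linear_poly c) \<in> chart_ideal i (base_locus g h)"
    if c: "c \<noteq> 0" "related c g h" for c i
  proof -
    have "dir_deriv w g * dir_deriv u h = dir_deriv u g * dir_deriv w h"
      if "poly_eval (linear_poly c) u = 0" "poly_eval (linear_poly c) w = 0" for u w
      using related_minor_eq_0[OF c(2,1) that] by (simp add: minor_def)
    then obtain e where "linear_poly c ^ e \<in> base_locus g h"
      using linear_power_in_ideal[OF _ assms(2,3,5) c(1) _ nzd] assms(1) unfolding base_locus_def by auto
    then show ?thesis
      using assms(7) by (rule linear_poly_in_chart_ideal)
  qed
  \<comment> \<open>If a nonzero relation exists, \<open>i\<close> is a coordinate where it does not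
    vanish; otherwise every \<open>i\<close> will do.\<close>
  have "\<exists>i. \<forall>c. related c g h \<longrightarrow> c $ i = 0 \<longrightarrow> c = 0"
  proof (cases "\<exists>c. c \<noteq> 0 \<and> related c g h")
    case True
    then obtain c where c: "c \<noteq> 0" "related c g h"
      by blast
    then obtain i where i: "c $ i \<noteq> 0"
      by (auto simp: vec_eq_iff)
    have "c' = 0" if "related c' g h" "c' $ i = 0" for c'
      using related_unique[OF assms(1-5) nzd chart[OF c] c(2) that(1) i that(2)] .
    then show ?thesis
      by blast
  qed blast
  then obtain i where "\<And>c. related c g h \<Longrightarrow> c $ i = 0 \<Longrightarrow> c = 0"
    by blast
  then have "forms.dim (range (\<lambda>j. pencil_form_at j g h)) \<in> {3, 4}"
    by (rule dim_pencil_forms)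
  moreover have "range (\<lambda>j. pencil_form_at j g h) = {pencil_form_at Cx g h, pencil_form_at Cy g h,
      pencil_form_at Cz g h, pencil_form_at Ct g h}"
    by (simp add: UNIV_coord)
  ultimately show ?thesis
    using chart subscheme_of_surface by (simp add: sum_coord)
qed

end
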